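(* Let $G$ be a stable commutative group (written multiplicatively) of finite weight. Then for all but finitely many primes $q$, the subgroup $G^q=\{g^q: g\in G\}$ has finite index in $G$. More precisely, if $w(G)=w<\omega$, then there are at most $w$ many primes $q$ such that the index $[G:G^q]$ is infinite.
   Context: A stable group is a group $G$ considered as a first-order structure, endowed with its group operation and possibly additional relations, such that $\mathrm{Th}(G)$ is stable. By convention $G$ is a monster model (very saturated model) of its theory, and sets of parameters are small, i.e. of cardinality less than the degree of saturation. All complete types are finitary. Generics: a definable subset $X$ of $G$ is generic if finitely many translates of $X$ cover $G$; a complete type over a set $A$ is generic if every formula in it defines a generic set. Weight: in a stable theory with monster model $\mathfrak{C}$, for $A\subseteq \mathfrak{C}$ and $p\in S(A)$, the weight of $p$ is the supremum of the cardinalities $\kappa$ for which there exist a non-forking extension $q=\mathrm{tp}(a/B)\in S(B)$ of $p$ and a $B$-independent sequence $(b_i:i<\kappa)$ (of finite tuples) such that for every $i<\kappa$, $a$ is not independent (in the sense of forking) from $b_i$ over $A$. A stable group $G$ has weight $\alpha$, written $w(G)=\alpha$, if every (equivalently, some) generic type of $G$ has weight $\alpha$. *)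

theory Defs
  imports
    "HOL-Algebra.Coset"
    "HOL-Computational_Algebra.Primes"
    "HOL-Library.Extended_Nat"
begin

unbundle cardinal_syntax

section \<open>Groups with additional relations as first-order structures\<close>

text \<open>
  The language has a binary function symbol for the group operation and a relation symbol for
  each element of the type \<open>'r\<close>; the identity and inversion are definable from the operation.
  An empty \<open>rel G\<close> everywhere gives a pure group.
\<close>

record ('a, 'r) rel_group = "'a monoid" +
  rel :: "'r \<Rightarrow> 'a list set"

text \<open>
  Every relation symbol denotes a relation on the group of some fixed finite arity. Atoms with
  the wrong number of arguments are simply false, so no arity check on formulas is needed.
\<close>

definition relations_wf :: "('a, 'r) rel_group \<Rightarrow> bool" where
  "relations_wf G \<longleftrightarrow>
     (\<forall>r. \<exists>k. rel G r \<subseteq> {xs. length xs = k \<and> set xs \<subseteq> carrier G})"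

text \<open>
  Formulas may contain parameters (\<open>Const\<close>); formulas of the language itself are those whose
  parameter set is empty. Variables are named by natural numbers.
\<close>

datatype 'a trm = Var nat | Const 'a | Mult "'a trm" "'a trm"

datatype ('a, 'r) fm =
    Eq "'a trm" "'a trm"
  | Rel 'r "'a trm list"
  | Neg "('a, 'r) fm"
  | Conj "('a, 'r) fm" "('a, 'r) fm"
  | Ex nat "('a, 'r) fm"

primrec fv_trm :: "'a trm \<Rightarrow> nat set" where
  "fv_trm (Var v) = {v}"
| "fv_trm (Const a) = {}"
| "fv_trm (Mult s t) = fv_trm s \<union> fv_trm t"

primrec params_trm :: "'a trm \<Rightarrow> 'a set" where
  "params_trm (Var v) = {}"
| "params_trm (Const a) = {a}"
| "params_trm (Mult s t) = params_trm s \<union> params_trm t"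

primrec fv :: "('a, 'r) fm \<Rightarrow> nat set" where
  "fv (Eq s t) = fv_trm s \<union> fv_trm t"
| "fv (Rel r ts) = (\<Union>t\<in>set ts. fv_trm t)"
| "fv (Neg \<phi>) = fv \<phi>"
| "fv (Conj \<phi> \<psi>) = fv \<phi> \<union> fv \<psi>"
| "fv (Ex v \<phi>) = fv \<phi> - {v}"

primrec params :: "('a, 'r) fm \<Rightarrow> 'a set" where
  "params (Eq s t) = params_trm s \<union> params_trm t"
| "params (Rel r ts) = (\<Union>t\<in>set ts. params_trm t)"
| "params (Neg \<phi>) = params \<phi>"
| "params (Conj \<phi> \<psi>) = params \<phi> \<union> params \<psi>"
| "params (Ex v \<phi>) = params \<phi>"

primrec eval_trm :: "('a, 'r) rel_group \<Rightarrow> (nat \<Rightarrow> 'a) \<Rightarrow> 'a trm \<Rightarrow> 'a" where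
  "eval_trm G e (Var v) = e v"
| "eval_trm G e (Const a) = a"
| "eval_trm G e (Mult s t) = eval_trm G e s \<otimes>\<^bsub>G\<^esub> eval_trm G e t"

primrec sat :: "('a, 'r) rel_group \<Rightarrow> (nat \<Rightarrow> 'a) \<Rightarrow> ('a, 'r) fm \<Rightarrow> bool" where
  "sat G e (Eq s t) \<longleftrightarrow> eval_trm G e s = eval_trm G e t"
| "sat G e (Rel r ts) \<longleftrightarrow> map (eval_trm G e) ts \<in> rel G r"
| "sat G e (Neg \<phi>) \<longleftrightarrow> \<not> sat G e \<phi>"
| "sat G e (Conj \<phi> \<psi>) \<longleftrightarrow> sat G e \<phi> \<and> sat G e \<psi>"
| "sat G e (Ex v \<phi>) \<longleftrightarrow> (\<exists>x\<in>carrier G. sat G (e(v := x)) \<phi>)"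

text \<open>The formulas over \<open>A\<close> in the free variables \<open>x\<^sub>0, \<dots>, x\<^sub>n\<^sub>-\<^sub>1\<close>.\<close>

definition fmls :: "nat \<Rightarrow> 'a set \<Rightarrow> ('a, 'r) fm set" where
  "fmls n A = {\<phi>. fv \<phi> \<subseteq> {..<n} \<and> params \<phi> \<subseteq> A}"

definition tuples :: "('a, 'r) rel_group \<Rightarrow> nat \<Rightarrow> 'a list set" where
  "tuples G n = {xs. length xs = n \<and> set xs \<subseteq> carrier G}"

text \<open>
  \<open>holds G xs \<phi>\<close> is only used when the free variables of \<open>\<phi>\<close> are below \<open>length xs\<close>, so
  the values of \<open>(!) xs\<close> out of range are irrelevant.
\<close>

abbreviation holds :: "('a, 'r) rel_group \<Rightarrow> 'a list \<Rightarrow> ('a, 'r) fm \<Rightarrow> bool" where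
  "holds G xs \<phi> \<equiv> sat G ((!) xs) \<phi>"


section \<open>Types, saturation, stability\<close>

definition tp :: "('a, 'r) rel_group \<Rightarrow> 'a list \<Rightarrow> 'a set \<Rightarrow> ('a, 'r) fm set" where
  "tp G xs A = {\<phi> \<in> fmls (length xs) A. holds G xs \<phi>}"

text \<open>
  The space of complete \<open>n\<close>-types over \<open>A\<close>. Finite satisfiability in \<open>G\<close> is consistency with
  the theory of \<open>G\<close> expanded by names for the elements of \<open>A\<close>.
\<close>

definition complete_types :: "('a, 'r) rel_group \<Rightarrow> nat \<Rightarrow> 'a set \<Rightarrow> ('a, 'r) fm set set" where
  "complete_types G n A =
     {p. p \<subseteq> fmls n A \<and>
         (\<forall>F. finite F \<and> F \<subseteq> p \<longrightarrow> (\<exists>xs\<in>tuples G n. \<forall>\<phi>\<in>F. holds G xs \<phi>)) \<and>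
         (\<forall>\<phi>\<in>fmls n A. \<phi> \<in> p \<or> Neg \<phi> \<in> p)}"

definition small :: "('a, 'r) rel_group \<Rightarrow> 'k rel \<Rightarrow> 'a set \<Rightarrow> bool" where
  "small G \<kappa> A \<longleftrightarrow> A \<subseteq> carrier G \<and> |A| <o \<kappa>"

definition saturated :: "('a, 'r) rel_group \<Rightarrow> 'k rel \<Rightarrow> bool" where
  "saturated G \<kappa> \<longleftrightarrow>
     (\<forall>A n. small G \<kappa> A \<longrightarrow>
        (\<forall>p\<in>complete_types G n A. \<exists>xs\<in>tuples G n. tp G xs A = p))"

text \<open>
  The degree of saturation \<open>\<kappa>\<close> may be any cardinal exceeding the cardinality of the set of
  formulas of the language, i.e. exceeding both \<open>\<aleph>\<^sub>0\<close> and the number of relation symbols.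
\<close>

definition monster :: "('a, 'r) rel_group \<Rightarrow> 'k rel \<Rightarrow> bool" where
  "monster G \<kappa> \<longleftrightarrow>
     Card_order \<kappa> \<and> natLeq <o \<kappa> \<and> |UNIV :: 'r set| <o \<kappa> \<and> saturated G \<kappa>"

text \<open>
  Stability of the theory of \<open>G\<close>: no formula \<open>\<phi>(x; y)\<close> has the order property. For each \<open>N\<close> the
  existence of a ladder of length \<open>N\<close> is a first-order sentence, so by compactness ladders of all
  finite lengths in \<open>G\<close> amount to an infinite ladder in some model of the theory of \<open>G\<close>.
\<close>

definition ladder ::
  "('a, 'r) rel_group \<Rightarrow> nat \<Rightarrow> nat \<Rightarrow> ('a, 'r) fm \<Rightarrow> nat \<Rightarrow> bool" where
  "ladder G n m \<phi> N \<longleftrightarrow>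
     (\<exists>a b. (\<forall>i<N. a i \<in> tuples G n \<and> b i \<in> tuples G m) \<and>
            (\<forall>i<N. \<forall>j<N. holds G (a i @ b j) \<phi> \<longleftrightarrow> i < j))"

definition stable_theory :: "('a, 'r) rel_group \<Rightarrow> bool" where
  "stable_theory G \<longleftrightarrow> (\<forall>n m. \<forall>\<phi>\<in>fmls (n + m) {}. \<exists>N. \<not> ladder G n m \<phi> N)"


section \<open>Forking\<close>

text \<open>
  \<open>divides G A n \<phi> b\<close>: the formula \<open>\<phi>(x, b)\<close> divides over \<open>A\<close>, where \<open>x\<close> are the first \<open>n\<close>
  variables of \<open>\<phi>\<close> and \<open>b\<close> is substituted for the remaining ones.
\<close>

definition divides ::
  "('a, 'r) rel_group \<Rightarrow> 'a set \<Rightarrow> nat \<Rightarrow> ('a, 'r) fm \<Rightarrow> 'a list \<Rightarrow> bool" where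
  "divides G A n \<phi> b \<longleftrightarrow>
     (\<exists>k. \<exists>bs :: nat \<Rightarrow> 'a list.
        (\<forall>i. bs i \<in> tuples G (length b) \<and> tp G (bs i) A = tp G b A) \<and>
        (\<forall>K. finite K \<and> card K = k \<longrightarrow>
           \<not> (\<exists>xs\<in>tuples G n. \<forall>i\<in>K. holds G (xs @ bs i) \<phi>)))"

text \<open>
  A partial type \<open>\<pi>\<close> in \<open>n\<close> variables forks over \<open>A\<close> if it implies a finite disjunction of
  formulas dividing over \<open>A\<close>; being a consequence of \<open>\<pi>\<close> means following from a finite part.
\<close>

definition forks ::
  "('a, 'r) rel_group \<Rightarrow> 'a set \<Rightarrow> nat \<Rightarrow> ('a, 'r) fm set \<Rightarrow> bool" where
  "forks G A n \<pi> \<longleftrightarrow>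
     (\<exists>\<pi>\<^sub>0 \<Delta>. finite \<pi>\<^sub>0 \<and> \<pi>\<^sub>0 \<subseteq> \<pi> \<and> finite \<Delta> \<and>
        (\<forall>(\<phi>, b)\<in>\<Delta>. set b \<subseteq> carrier G \<and> \<phi> \<in> fmls (n + length b) {} \<and> divides G A n \<phi> b) \<and>
        (\<forall>xs\<in>tuples G n. (\<forall>\<psi>\<in>\<pi>\<^sub>0. holds G xs \<psi>) \<longrightarrow> (\<exists>(\<phi>, b)\<in>\<Delta>. holds G (xs @ b) \<phi>)))"

text \<open>\<open>indep G a A B\<close>: the tuple \<open>a\<close> is independent from \<open>B\<close> over \<open>A\<close>.\<close>

definition indep :: "('a, 'r) rel_group \<Rightarrow> 'a list \<Rightarrow> 'a set \<Rightarrow> 'a set \<Rightarrow> bool" where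
  "indep G a A B \<longleftrightarrow> \<not> forks G A (length a) (tp G a (A \<union> B))"

text \<open>
  A \<open>B\<close>-independent sequence of length \<open>\<alpha> \<le> \<omega>\<close>. In a stable theory one may equivalently ask that
  each \<open>b\<^sub>i\<close> be independent over \<open>B\<close> from all the other members, by symmetry of forking.
\<close>

definition indep_seq ::
  "('a, 'r) rel_group \<Rightarrow> 'a set \<Rightarrow> enat \<Rightarrow> (nat \<Rightarrow> 'a list) \<Rightarrow> bool" where
  "indep_seq G B \<alpha> b \<longleftrightarrow>
     (\<forall>i. enat i < \<alpha> \<longrightarrow> set (b i) \<subseteq> carrier G \<and> indep G (b i) B (\<Union>j<i. set (b j)))"


section \<open>Weight and generic types\<close>

text \<open>
  The weight of \<open>p \<in> S(A)\<close>, with all infinite cardinals identified with \<open>\<infinity>\<close>. Restricting to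
  sequences of length at most \<open>\<omega>\<close> loses nothing: initial segments of witnesses are witnesses.
  The type of \<open>a\<close> over \<open>B\<close> is the non-forking extension of \<open>p\<close>.
\<close>

definition weight ::
  "('a, 'r) rel_group \<Rightarrow> 'k rel \<Rightarrow> 'a set \<Rightarrow> ('a, 'r) fm set \<Rightarrow> enat" where
  "weight G \<kappa> A p = Sup {\<alpha>. \<exists>B a b.
     A \<subseteq> B \<and> small G \<kappa> B \<and> set a \<subseteq> carrier G \<and> tp G a A = p \<and>
     \<not> forks G A (length a) (tp G a B) \<and>
     indep_seq G B \<alpha> b \<and>
     (\<forall>i. enat i < \<alpha> \<longrightarrow> \<not> indep G a A (set (b i)))}"

definition generic_set :: "('a, 'r) rel_group \<Rightarrow> 'a set \<Rightarrow> bool" where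
  "generic_set G X \<longleftrightarrow>
     (\<exists>F. finite F \<and> F \<subseteq> carrier G \<and> carrier G = (\<Union>g\<in>F. g <#\<^bsub>G\<^esub> X))"

definition generic_type ::
  "('a, 'r) rel_group \<Rightarrow> 'a set \<Rightarrow> ('a, 'r) fm set \<Rightarrow> bool" where
  "generic_type G A p \<longleftrightarrow>
     p \<in> complete_types G 1 A \<and> (\<forall>\<phi>\<in>p. generic_set G {x \<in> carrier G. holds G [x] \<phi>})"

definition group_has_weight :: "('a, 'r) rel_group \<Rightarrow> 'k rel \<Rightarrow> enat \<Rightarrow> bool" where
  "group_has_weight G \<kappa> \<alpha> \<longleftrightarrow>
     (\<forall>A p. small G \<kappa> A \<and> generic_type G A p \<longrightarrow> weight G \<kappa> A p = \<alpha>)"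

definition power_subgroup :: "('a, 'r) rel_group \<Rightarrow> nat \<Rightarrow> 'a set" where
  "power_subgroup G q = {g [^]\<^bsub>G\<^esub> q | g. g \<in> carrier G}"

end

theory Submission
  imports Defs "HOL-Algebra.FiniteProduct"
begin

text \<open>
  Let \<open>g\<^sub>0, g\<^sub>1, \<dots>\<close> be a sequence in which each \<open>g\<^sub>n\<close> realizes the restriction of a fixed global
  generic type to the previous terms. For distinct primes \<open>q\<^sub>i\<close>, \<open>i < n\<close>, with \<open>[G : G\<^bsup>q\<^esup>]\<close> infinite
  for each \<open>q = q\<^sub>i\<close>, put \<open>Q\<^sub>i = \<Prod>\<^bsub>j \<noteq> i\<^esub> q\<^sub>j\<close> and let \<open>a\<close> be the product of the powers of \<open>g\<^sub>i\<close> with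
  exponent \<open>Q\<^sub>i\<close>. Modulo \<open>q\<^sub>i\<close>-th powers, \<open>a\<close> is the \<open>Q\<^sub>i\<close>-th power of \<open>g\<^sub>i\<close>, and the corresponding cosets
  for \<open>g\<^sub>0, g\<^sub>1, \<dots>\<close> are pairwise disjoint, so \<open>a\<close> forks with \<open>g\<^sub>i\<close> over the empty set. Since the \<open>Q\<^sub>i\<close>
  generate the unit ideal, \<open>a\<close> is generic, and so its type has weight at least \<open>n\<close>.

  Two facts about a definable set \<open>X\<close> replace the general theory of forking. If \<open>X\<close> is not generic,
  then by stability it has an infinite \<open>k\<close>-inconsistent sequence of translates. If \<open>X\<close> is generic, then
  double counting in a finite set of small doubling, which exists because \<open>G\<close> is commutative, shows that
  sufficiently many sets covering \<open>G\<close> by as few translates as \<open>X\<close> include \<open>k\<close> with a common point.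
\<close>

section \<open>Substitution\<close>

lemma eval_trm_cong:
  "(\<And>i. i \<in> fv_trm t \<Longrightarrow> e i = e' i) \<Longrightarrow> eval_trm G e t = eval_trm G e' t"
  by (induction t) auto

lemma sat_cong:
  "(\<And>i. i \<in> fv \<phi> \<Longrightarrow> e i = e' i) \<Longrightarrow> sat G e \<phi> = sat G e' \<phi>"
proof (induction \<phi> arbitrary: e e')
  case (Eq s t)
  then show ?case by (simp cong: eval_trm_cong)
next
  case (Rel r ts)
  then have "map (eval_trm G e) ts = map (eval_trm G e') ts"
    by (auto intro: eval_trm_cong)
  then show ?case by (simp del: map_eq_conv)
next
  case (Neg \<phi>)
  then show ?case by (metis fv.simps(3) sat.simps(3))
next
  case (Conj \<phi> \<psi>)
  then show ?case by (metis UnCI fv.simps(4) sat.simps(4))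
next
  case (Ex v \<phi>)
  have "sat G (e(v := x)) \<phi> = sat G (e'(v := x)) \<phi>" for x
    by (rule Ex.IH) (use Ex.prems in auto)
  then show ?case by simp
qed

text \<open>Constants are substituted along with variables, so that the parameters of a formula can
  be turned into variables, as in \<open>translate_formula\<close>.\<close>

primrec subst_trm :: "(nat \<Rightarrow> 'a trm) \<Rightarrow> ('a \<Rightarrow> 'a trm) \<Rightarrow> 'a trm \<Rightarrow> 'a trm" where
  "subst_trm \<sigma> \<tau> (Var v) = \<sigma> v"
| "subst_trm \<sigma> \<tau> (Const a) = \<tau> a"
| "subst_trm \<sigma> \<tau> (Mult s t) = Mult (subst_trm \<sigma> \<tau> s) (subst_trm \<sigma> \<tau> t)"

text \<open>
  Bound variables are moved up by \<open>K\<close>, so terms whose variables are below \<open>K\<close> are never captured.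
\<close>

primrec subst ::
  "nat \<Rightarrow> (nat \<Rightarrow> 'a trm) \<Rightarrow> ('a \<Rightarrow> 'a trm) \<Rightarrow> ('a, 'r) fm \<Rightarrow> ('a, 'r) fm" where
  "subst K \<sigma> \<tau> (Eq s t) = Eq (subst_trm \<sigma> \<tau> s) (subst_trm \<sigma> \<tau> t)"
| "subst K \<sigma> \<tau> (Rel r ts) = Rel r (map (subst_trm \<sigma> \<tau>) ts)"
| "subst K \<sigma> \<tau> (Neg \<phi>) = Neg (subst K \<sigma> \<tau> \<phi>)"
| "subst K \<sigma> \<tau> (Conj \<phi> \<psi>) = Conj (subst K \<sigma> \<tau> \<phi>) (subst K \<sigma> \<tau> \<psi>)"
| "subst K \<sigma> \<tau> (Ex v \<phi>) = Ex (K + v) (subst K (\<sigma>(v := Var (K + v))) \<tau> \<phi>)"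

lemma fv_subst_trm:
  "fv_trm (subst_trm \<sigma> \<tau> t) = (\<Union>i\<in>fv_trm t. fv_trm (\<sigma> i)) \<union> (\<Union>a\<in>params_trm t. fv_trm (\<tau> a))"
  by (induction t) auto

lemma params_subst_trm:
  "params_trm (subst_trm \<sigma> \<tau> t) =
     (\<Union>i\<in>fv_trm t. params_trm (\<sigma> i)) \<union> (\<Union>a\<in>params_trm t. params_trm (\<tau> a))"
  by (induction t) auto

lemma fv_subst:
  "fv (subst K \<sigma> \<tau> \<phi>) \<subseteq> (\<Union>i\<in>fv \<phi>. fv_trm (\<sigma> i)) \<union> (\<Union>a\<in>params \<phi>. fv_trm (\<tau> a))"
proof (induction \<phi> arbitrary: \<sigma>)
  case (Ex v \<phi>)
  let ?\<sigma> = "\<sigma>(v := Var (K + v))"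
  have "(\<Union>i\<in>fv \<phi>. fv_trm (?\<sigma> i)) \<subseteq> (\<Union>i\<in>fv \<phi> - {v}. fv_trm (\<sigma> i)) \<union> {K + v}"
    by (auto split: if_splits)
  with Ex.IH[of ?\<sigma>] have "fv (subst K ?\<sigma> \<tau> \<phi>)
      \<subseteq> (\<Union>i\<in>fv \<phi> - {v}. fv_trm (\<sigma> i)) \<union> {K + v} \<union> (\<Union>a\<in>params \<phi>. fv_trm (\<tau> a))"
    by (meson Un_mono order_refl order_trans)
  then show ?case by auto
next
  case (Rel r ts)
  show ?case by (simp add: fv_subst_trm) blast
next
  case (Conj \<phi> \<psi>)
  show ?case using Conj.IH[of \<sigma>] by simp blast
qed (simp_all add: fv_subst_trm, blast)

lemma params_subst:
  "params (subst K \<sigma> \<tau> \<phi>) \<subseteq>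
     (\<Union>i\<in>fv \<phi>. params_trm (\<sigma> i)) \<union> (\<Union>a\<in>params \<phi>. params_trm (\<tau> a))"
proof (induction \<phi> arbitrary: \<sigma>)
  case (Ex v \<phi>)
  let ?\<sigma> = "\<sigma>(v := Var (K + v))"
  have "(\<Union>i\<in>fv \<phi>. params_trm (?\<sigma> i)) \<subseteq> (\<Union>i\<in>fv \<phi> - {v}. params_trm (\<sigma> i))"
    by (auto split: if_splits)
  with Ex.IH[of ?\<sigma>] have "params (subst K ?\<sigma> \<tau> \<phi>)
      \<subseteq> (\<Union>i\<in>fv \<phi> - {v}. params_trm (\<sigma> i)) \<union> (\<Union>a\<in>params \<phi>. params_trm (\<tau> a))"
    by (meson Un_mono order_refl order_trans)
  then show ?case by simp
next
  case (Rel r ts)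
  show ?case by (simp add: params_subst_trm) blast
next
  case (Conj \<phi> \<psi>)
  show ?case using Conj.IH[of \<sigma>] by simp blast
qed (simp_all add: params_subst_trm, blast)

lemma subst_in_fmls:
  assumes "\<And>i. i \<in> fv \<phi> \<Longrightarrow> fv_trm (\<sigma> i) \<subseteq> {..<n} \<and> params_trm (\<sigma> i) \<subseteq> A"
    and "\<And>a. a \<in> params \<phi> \<Longrightarrow> fv_trm (\<tau> a) \<subseteq> {..<n} \<and> params_trm (\<tau> a) \<subseteq> A"
  shows "subst K \<sigma> \<tau> \<phi> \<in> fmls n A"
  using fv_subst[of K \<sigma> \<tau> \<phi>] params_subst[of K \<sigma> \<tau> \<phi>] assms
  unfolding fmls_def by blast

lemma eval_subst_trm:
  "(\<And>a. a \<in> params_trm t \<Longrightarrow> eval_trm G e (\<tau> a) = a) \<Longrightarrow>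
     eval_trm G e (subst_trm \<sigma> \<tau> t) = eval_trm G (\<lambda>i. eval_trm G e (\<sigma> i)) t"
  by (induction t) auto

text \<open>The bound on \<open>fv_trm (\<sigma> i)\<close> survives a quantifier: the new bound
  variable \<open>K + v\<close> can occur in \<open>\<sigma> i\<close> only for
  \<open>i = v\<close>, and there the value is overwritten. It also admits
  \<open>Var (K + i)\<close> as a filler for variables that do not occur in
  \<open>\<phi>\<close>.\<close>

lemma sat_subst:
  assumes "\<And>i. fv_trm (\<sigma> i) \<subseteq> {..<K} \<union> {K + i}"
    and "\<And>a. a \<in> params \<phi> \<Longrightarrow> fv_trm (\<tau> a) \<subseteq> {..<K}"
    and "\<And>a. a \<in> params \<phi> \<Longrightarrow> eval_trm G e (\<tau> a) = a"
  shows "sat G e (subst K \<sigma> \<tau> \<phi>) = sat G (\<lambda>i. eval_trm G e (\<sigma> i)) \<phi>"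
  using assms
proof (induction \<phi> arbitrary: \<sigma> e)
  case (Eq s t)
  then show ?case by (simp add: eval_subst_trm)
next
  case (Rel r ts)
  have "map (eval_trm G e \<circ> subst_trm \<sigma> \<tau>) ts
      = map (eval_trm G (\<lambda>i. eval_trm G e (\<sigma> i))) ts"
    using Rel.prems(3) by (auto intro!: eval_subst_trm)
  then show ?case by (simp only: sat.simps subst.simps map_map)
next
  case (Neg \<phi>)
  then show ?case by simp
next
  case (Conj \<phi> \<psi>)
  then show ?case by simp
next
  case (Ex v \<phi>)
  have "sat G (e(K + v := x)) (subst K (\<sigma>(v := Var (K + v))) \<tau> \<phi>)
      = sat G ((\<lambda>i. eval_trm G e (\<sigma> i))(v := x)) \<phi>" for x
  proof -
    have "sat G (e(K + v := x)) (subst K (\<sigma>(v := Var (K + v))) \<tau> \<phi>)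
        = sat G (\<lambda>i. eval_trm G (e(K + v := x)) ((\<sigma>(v := Var (K + v))) i)) \<phi>"
    proof (rule Ex.IH)
      fix a assume a: "a \<in> params \<phi>"
      then have "eval_trm G (e(K + v := x)) (\<tau> a) = eval_trm G e (\<tau> a)"
        using Ex.prems(2)[of a] by (intro eval_trm_cong) auto
      then show "eval_trm G (e(K + v := x)) (\<tau> a) = a"
        using Ex.prems(3)[of a] a by simp
    qed (use Ex.prems in auto)
    also have "(\<lambda>i. eval_trm G (e(K + v := x)) ((\<sigma>(v := Var (K + v))) i))
        = (\<lambda>i. eval_trm G e (\<sigma> i))(v := x)"
    proof
      fix i
      have "eval_trm G (e(K + v := x)) (\<sigma> i) = eval_trm G e (\<sigma> i)" if "i \<noteq> v"
        using Ex.prems(1)[of i] that by (intro eval_trm_cong) auto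
      then show "eval_trm G (e(K + v := x)) ((\<sigma>(v := Var (K + v))) i)
          = ((\<lambda>i. eval_trm G e (\<sigma> i))(v := x)) i" by simp
    qed
    finally show ?thesis .
  qed
  then show ?case by simp
qed

lemma finite_params_trm: "finite (params_trm t)"
  by (induction t) auto

lemma finite_params: "finite (params \<phi>)"
  by (induction \<phi>) (auto simp: finite_params_trm)

section \<open>Finite Boolean combinations and blocks of existential quantifiers\<close>

lemma fmls_mono: "A \<subseteq> B \<Longrightarrow> fmls n A \<subseteq> fmls n B"
  unfolding fmls_def by auto

lemma Neg_fmls_iff [simp]: "Neg \<phi> \<in> fmls n A \<longleftrightarrow> \<phi> \<in> fmls n A"
  unfolding fmls_def by auto

lemma Conj_fmls_iff [simp]: "Conj \<phi> \<psi> \<in> fmls n A \<longleftrightarrow> \<phi> \<in> fmls n A \<and> \<psi> \<in> fmls n A"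
  unfolding fmls_def by auto

lemma finite_conj_formula:
  fixes G :: "('a, 'r) rel_group"
  assumes "finite F" "F \<subseteq> fmls n A" "0 < n"
  shows "\<exists>\<psi>\<in>fmls n A. \<forall>e. sat G e \<psi> \<longleftrightarrow> (\<forall>\<phi>\<in>F. sat G e \<phi>)"
  using assms
proof (induction F rule: finite_induct)
  case empty
  have "Eq (Var 0) (Var 0) \<in> (fmls n A :: ('a, 'r) fm set)" using assms(3) by (auto simp: fmls_def)
  then show ?case by (intro bexI[of _ "Eq (Var 0) (Var 0)"]) auto
next
  case (insert \<phi> F)
  then obtain \<psi> where "\<psi> \<in> fmls n A" "\<forall>e. sat G e \<psi> \<longleftrightarrow> (\<forall>\<phi>\<in>F. sat G e \<phi>)" by auto
  then show ?case using insert.prems by (intro bexI[of _ "Conj \<phi> \<psi>"]) auto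
qed

lemma finite_disj_formula:
  fixes G :: "('a, 'r) rel_group"
  assumes "finite F" "F \<subseteq> fmls n A" "0 < n"
  shows "\<exists>\<psi>\<in>fmls n A. \<forall>e. sat G e \<psi> \<longleftrightarrow> (\<exists>\<phi>\<in>F. sat G e \<phi>)"
proof -
  obtain \<psi> where "\<psi> \<in> fmls n A" "\<forall>e. sat G e \<psi> \<longleftrightarrow> (\<forall>\<phi>\<in>Neg ` F. sat G e \<phi>)"
    using finite_conj_formula[of "Neg ` F" n A G] assms by (metis (no_types, lifting) Neg_fmls_iff finite_imageI image_subsetI subsetD)
  then show ?thesis by (intro bexI[of _ "Neg \<psi>"]) auto
qed

text \<open>The variables from \<open>m\<close> to \<open>m + N - 1\<close> are bound one at a time.
  The witness is a total sequence whose entries from \<open>N\<close> on are arbitrary; a nonempty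
  carrier supplies them.\<close>

lemma Ex_tuple_formula:
  fixes G :: "('a, 'r) rel_group"
  assumes ne: "carrier G \<noteq> {}" and "\<chi> \<in> fmls (m + N) A"
  shows "\<exists>\<theta>\<in>fmls m A. \<forall>e. sat G e \<theta> \<longleftrightarrow>
    (\<exists>z. (\<forall>j. z j \<in> carrier G) \<and> sat G (\<lambda>i. if i < m then e i else z (i - m)) \<chi>)"
  using assms(2)
proof (induction N arbitrary: \<chi>)
  case 0
  have eq: "sat G (\<lambda>i. if i < m then e i else z (i - m)) \<chi> = sat G e \<chi>" for e z
    using 0 by (intro sat_cong) (auto simp: fmls_def)
  from ne obtain x where "x \<in> carrier G" by blast
  then have "\<exists>z :: nat \<Rightarrow> 'a. \<forall>j. z j \<in> carrier G" by (intro exI[of _ "\<lambda>_. x"]) simp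
  then show ?case using 0 unfolding eq add_0_right by blast
next
  case (Suc N)
  have "Ex (m + N) \<chi> \<in> fmls (m + N) A"
    using Suc.prems by (auto simp: fmls_def less_Suc_eq)
  from Suc.IH[OF this] obtain \<theta> where \<theta>: "\<theta> \<in> fmls m A"
    "\<forall>e. sat G e \<theta> \<longleftrightarrow> (\<exists>z. (\<forall>j. z j \<in> carrier G) \<and>
       sat G (\<lambda>i. if i < m then e i else z (i - m)) (Ex (m + N) \<chi>))" by blast
  have eq: "(\<lambda>i. if i < m then e i else z (i - m))(m + N := x)
      = (\<lambda>i. if i < m then e i else (z(N := x)) (i - m))" for e z :: "nat \<Rightarrow> 'a" and x
    by (auto simp: fun_eq_iff)
  have "sat G e \<theta> \<longleftrightarrow>
      (\<exists>z. (\<forall>j. z j \<in> carrier G) \<and> sat G (\<lambda>i. if i < m then e i else z (i - m)) \<chi>)"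
    (is "_ \<longleftrightarrow> ?R") for e
  proof
    assume "sat G e \<theta>"
    then obtain z where z: "\<forall>j. z j \<in> carrier G"
      "sat G (\<lambda>i. if i < m then e i else z (i - m)) (Ex (m + N) \<chi>)" using \<theta>(2) by blast
    then obtain x where x: "x \<in> carrier G"
      "sat G (\<lambda>i. if i < m then e i else (z(N := x)) (i - m)) \<chi>" unfolding sat.simps eq by blast
    have "\<forall>j. (z(N := x)) j \<in> carrier G" using z(1) x(1) by simp
    then show ?R using x(2) by blast
  next
    assume ?R
    then obtain z where z: "\<forall>j. z j \<in> carrier G"
      "sat G (\<lambda>i. if i < m then e i else z (i - m)) \<chi>" by blast
    have "sat G (\<lambda>i. if i < m then e i else (z(N := z N)) (i - m)) \<chi>"
      using z(2) unfolding fun_upd_triv .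
    then have "sat G (\<lambda>i. if i < m then e i else z (i - m)) (Ex (m + N) \<chi>)"
      using z(1) unfolding sat.simps eq by blast
    then show "sat G e \<theta>" using \<theta>(2) z(1) by blast
  qed
  then show ?case using \<theta>(1) by blast
qed

section \<open>Generic sets in commutative groups\<close>

text \<open>Genericity with a bound on the number of translates, which makes it expressible by a
  formula. The covering translates of \<open>X\<close> are those by the inverses of the
  \<open>z j\<close>; repetitions are allowed, and values from \<open>N\<close> on do not
  matter.\<close>

definition covers :: "('a, 'b) monoid_scheme \<Rightarrow> nat \<Rightarrow> 'a set \<Rightarrow> bool" where
  "covers G N X \<longleftrightarrow>
     (\<exists>z::nat \<Rightarrow> 'a. (\<forall>j. z j \<in> carrier G) \<and> (\<forall>x\<in>carrier G. \<exists>j<N. z j \<otimes>\<^bsub>G\<^esub> x \<in> X))"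

text \<open>Discrete boxes spanned by the listed elements. Their polynomial growth in
  \<open>n\<close> is the source of small doubling.\<close>

primrec box :: "('a, 'b) monoid_scheme \<Rightarrow> 'a list \<Rightarrow> nat \<Rightarrow> 'a set" where
  "box G [] n = {\<one>\<^bsub>G\<^esub>}"
| "box G (f # fs) n = (\<lambda>(i, y). f [^]\<^bsub>G\<^esub> i \<otimes>\<^bsub>G\<^esub> y) ` ({..n} \<times> box G fs n)"

section \<open>Polynomial growth, small doubling and double counting\<close>

context comm_group
begin

lemma finite_box: "finite (box G fs n)"
  by (induction fs) auto

lemma box_closed: "set fs \<subseteq> carrier G \<Longrightarrow> box G fs n \<subseteq> carrier G"
  by (induction fs) auto

lemma box_nonempty: "box G fs n \<noteq> {}"
  by (induction fs) auto

lemma card_box_le: "card (box G fs n) \<le> Suc n ^ length fs"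
proof (induction fs)
  case (Cons f fs)
  have "card (box G (f # fs) n) \<le> card ({..n} \<times> box G fs n)"
    unfolding box.simps by (intro card_image_le) (simp add: finite_box)
  also have "\<dots> \<le> Suc n * Suc n ^ length fs"
    unfolding card_cartesian_product card_atMost using Cons by (rule mult_le_mono2)
  finally show ?case by simp
qed simp

lemma box_mono: "box G fs n \<subseteq> box G fs (Suc n)"
proof (induction fs)
  case (Cons f fs)
  have "{..n} \<times> box G fs n \<subseteq> {..Suc n} \<times> box G fs (Suc n)" using Cons by auto
  then show ?case unfolding box.simps by (rule image_mono)
qed simp

lemma mult_box:
  "\<lbrakk>set fs \<subseteq> carrier G; g \<in> set fs; y \<in> box G fs n\<rbrakk> \<Longrightarrow> g \<otimes> y \<in> box G fs (Suc n)"
proof (induction fs arbitrary: y)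
  case (Cons f fs)
  obtain i y' where y: "y = f [^] i \<otimes> y'" "i \<le> n" "y' \<in> box G fs n"
    using Cons.prems(3) by auto
  have fg: "f \<in> carrier G" "g \<in> carrier G" and y': "y' \<in> carrier G"
    using Cons.prems y(3) box_closed[of fs n] by auto
  show ?case
  proof (cases "g = f")
    case True
    then have "g \<otimes> y = f [^] Suc i \<otimes> y'"
      using y(1) fg y' by (simp add: m_ac)
    moreover have "y' \<in> box G fs (Suc n)" using y(3) box_mono by blast
    ultimately show ?thesis using y(2) by (auto intro!: image_eqI[of _ _ "(Suc i, y')"])
  next
    case False
    then have "g \<otimes> y' \<in> box G fs (Suc n)" using Cons y(3) by auto
    moreover have "g \<otimes> y = f [^] i \<otimes> (g \<otimes> y')"
      using y(1) fg y' by (simp add: m_ac)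
    ultimately show ?thesis using y(2) by (auto intro!: image_eqI[of _ _ "(i, g \<otimes> y')"])
  qed
qed simp

text \<open>With \<open>Suc n\<close> a power of two only exponents have to be compared, a quadratic
  in \<open>d\<close> against an exponential.\<close>

lemma ex_power_less_two_power: "\<exists>n. Suc n ^ d < (2::nat) ^ n"
proof -
  have "2 * d * d + 4 * d + 2 < 16 * 4 ^ d"
    by (induction d) (auto simp: algebra_simps)
  moreover have "(2::nat) ^ (2 * d + 4) = 16 * 4 ^ d"
    by (simp add: power_add power_mult)
  ultimately have less: "(2 * d + 4) * d + 1 < (2::nat) ^ (2 * d + 4)"
    by (simp add: algebra_simps)
  define n where "n = (2::nat) ^ (2 * d + 4) - 1"
  have "Suc n ^ d = 2 ^ ((2 * d + 4) * d)"
    by (simp add: n_def power_mult)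
  also have "\<dots> < 2 ^ n"
    using less by (intro power_strict_increasing) (auto simp: n_def)
  finally show ?thesis by blast
qed

text \<open>Multiplication by an element of \<open>F\<close> leads from one box over
  \<open>F\<close> into the next. If every box were more than twice as large as its predecessor,
  their sizes would grow exponentially, against \<open>card_box_le\<close>.\<close>

lemma ex_small_doubling:
  assumes "finite F" "F \<subseteq> carrier G"
  shows "\<exists>S T. finite T \<and> T \<subseteq> carrier G \<and> S \<noteq> {} \<and> S \<subseteq> T \<and> card T \<le> 2 * card S \<and>
    (\<forall>f\<in>F. \<forall>y\<in>S. f \<otimes> y \<in> T)"
proof -
  obtain fs where fs: "set fs = F" using finite_list[OF assms(1)] by blast
  have "\<exists>n. card (box G fs (Suc n)) \<le> 2 * card (box G fs n)"
  proof (rule ccontr)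
    assume "\<not> ?thesis"
    then have step: "2 * card (box G fs n) < card (box G fs (Suc n))" for n
      by (simp add: not_le)
    have "2 ^ n \<le> card (box G fs n)" for n
    proof (induction n)
      case 0
      then show ?case using box_nonempty finite_box by (simp add: Suc_le_eq card_gt_0_iff)
    next
      case (Suc n)
      then show ?case using step[of n] by simp
    qed
    then have "2 ^ n \<le> Suc n ^ length fs" for n using card_box_le le_trans by blast
    then show False using ex_power_less_two_power[of "length fs"] by (meson not_le)
  qed
  then obtain n where "card (box G fs (Suc n)) \<le> 2 * card (box G fs n)" by blast
  then show ?thesis
    using fs assms mult_box[of fs] box_closed[of fs] box_nonempty finite_box box_mono
    by (intro exI[of _ "box G fs n"] exI[of _ "box G fs (Suc n)"]) auto
qed

text \<open>
  In a finite set of small doubling, every set \<open>X i\<close> has density at least \<open>1 / (2 * N)\<close>, so the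
  claim follows by double counting.
\<close>

lemma covers_common_point:
  assumes fin: "finite I" and cov: "\<And>i. i \<in> I \<Longrightarrow> covers G N (X i)"
    and card: "2 * N * k \<le> card I" and N: "0 < N"
  shows "\<exists>x\<in>carrier G. k \<le> card {i\<in>I. x \<in> X i}"
proof (cases "I = {}")
  case True
  then show ?thesis using card N by auto
next
  case False
  obtain z where z: "\<And>i j. i \<in> I \<Longrightarrow> z i j \<in> carrier G"
    "\<And>i x. i \<in> I \<Longrightarrow> x \<in> carrier G \<Longrightarrow> \<exists>j<N. z i j \<otimes> x \<in> X i"
    using cov unfolding covers_def by metis
  \<comment> \<open>Collecting all translating elements in one finite set lets a single pair
    \<open>S\<close>, \<open>T\<close> serve every \<open>X i\<close>.\<close>
  define F where "F = (\<Union>i\<in>I. z i ` {..<N})"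
  have F: "finite F" "F \<subseteq> carrier G" using fin z(1) by (auto simp: F_def)
  obtain S T where ST: "finite T" "T \<subseteq> carrier G" "S \<noteq> {}" "S \<subseteq> T"
    "card T \<le> 2 * card S" "\<forall>f\<in>F. \<forall>y\<in>S. f \<otimes> y \<in> T"
    using ex_small_doubling[OF F] by (elim exE conjE)
  have "finite S" using ST(1,4) finite_subset by blast
  have density: "card S \<le> N * card (T \<inter> X i)" if i: "i \<in> I" for i
  proof -
    \<comment> \<open>Multiplication by \<open>z i j\<close> carries this part of \<open>S\<close>
      injectively into \<open>T \<inter> X i\<close>, and the \<open>N\<close> parts exhaust
      \<open>S\<close>.\<close>
    have "card {y \<in> S. z i j \<otimes> y \<in> X i} \<le> card (T \<inter> X i)" if "j < N" for j
    proof (rule card_inj_on_le[where f = "\<lambda>y. z i j \<otimes> y"])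
      show "inj_on (\<lambda>y. z i j \<otimes> y) {y \<in> S. z i j \<otimes> y \<in> X i}"
        using ST(2,4) z(1)[OF i] by (intro inj_onI) (auto simp: subset_iff)
      show "(\<lambda>y. z i j \<otimes> y) ` {y \<in> S. z i j \<otimes> y \<in> X i} \<subseteq> T \<inter> X i"
        using ST(6) i that by (auto simp: F_def)
    qed (use ST(1) in auto)
    then have le: "(\<Sum>j<N. card {y \<in> S. z i j \<otimes> y \<in> X i}) \<le> (\<Sum>j<N. card (T \<inter> X i))"
      by (intro sum_mono) auto
    have "\<exists>j<N. z i j \<otimes> y \<in> X i" if "y \<in> S" for y
      using z(2)[OF i] ST(2,4) that by blast
    then have "S = (\<Union>j<N. {y \<in> S. z i j \<otimes> y \<in> X i})" by auto
    then have "card S = card (\<Union>j<N. {y \<in> S. z i j \<otimes> y \<in> X i})" by (rule arg_cong)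
    also have "\<dots> \<le> (\<Sum>j<N. card {y \<in> S. z i j \<otimes> y \<in> X i})"
      by (rule card_UN_le) simp
    also note le
    finally show ?thesis by simp
  qed
  have swap: "(\<Sum>i\<in>I. card (T \<inter> X i)) = (\<Sum>x\<in>T. card {i\<in>I. x \<in> X i})"
    using sum.swap_restrict[of I T "\<lambda>_ _. 1 :: nat" "\<lambda>i x. x \<in> X i"] fin ST(1)
    by (simp add: Int_def)
  have "\<exists>x\<in>T. k \<le> card {i\<in>I. x \<in> X i}"
  proof (rule ccontr)
    assume "\<not> ?thesis"
    then have "(\<Sum>x\<in>T. card {i\<in>I. x \<in> X i}) < (\<Sum>x\<in>T. k)"
      using ST(1,3,4) by (intro sum_strict_mono) auto
    then have "N * (\<Sum>i\<in>I. card (T \<inter> X i)) < N * (card T * k)"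
      using swap N by simp
    moreover have "card I * card S \<le> N * (\<Sum>i\<in>I. card (T \<inter> X i))"
      using sum_mono[of I "\<lambda>_. card S", OF density] by (simp add: sum_distrib_left)
    moreover have "N * (card T * k) \<le> N * (2 * card S * k)"
      using ST(5) by simp
    moreover have "2 * N * k * card S \<le> card I * card S"
      using card by simp
    moreover have "N * (2 * card S * k) = 2 * N * k * card S" by simp
    ultimately show False by linarith
  qed
  then show ?thesis using ST(2) by blast
qed

end

section \<open>Genericity as the existence of a covering number\<close>

locale stable_comm_group = comm_group G for G :: "('a, 'r) rel_group" (structure) +
  assumes stable: "stable_theory G"
begin

lemma generic_set_iff_covers:
  assumes "X \<subseteq> carrier G"
  shows "generic_set G X \<longleftrightarrow> (\<exists>N. covers G N X)"
proof
  assume "generic_set G X"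
  then obtain F where F: "finite F" "F \<subseteq> carrier G" "carrier G = (\<Union>g\<in>F. g <# X)"
    unfolding generic_set_def by blast
  obtain f and N :: nat where f: "F = f ` {..<N}"
    using F(1) by (metis finite_imp_nat_seg_image_inj_on lessThan_def)
  define z where "z j = (if j < N then inv (f j) else \<one>)" for j
  have "z j \<in> carrier G" for j using F(2) f by (auto simp: z_def)
  moreover have "\<exists>j<N. z j \<otimes> x \<in> X" if x: "x \<in> carrier G" for x
  proof -
    obtain j y where j: "j < N" "y \<in> X" "x = f j \<otimes> y"
      using subsetD[OF equalityD1[OF F(3)] x] unfolding f l_coset_def by auto
    moreover have "f j \<in> carrier G" "y \<in> carrier G" using j f F(2) assms by auto
    ultimately have "z j \<otimes> x = y" by (simp add: z_def m_assoc[symmetric])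
    then show ?thesis using j by blast
  qed
  ultimately show "\<exists>N. covers G N X" unfolding covers_def by blast
next
  assume "\<exists>N. covers G N X"
  then obtain N :: nat and z where z: "\<And>j. z j \<in> carrier G"
    "\<And>x. x \<in> carrier G \<Longrightarrow> \<exists>j<N. z j \<otimes> x \<in> X" unfolding covers_def by blast
  define F where "F = (\<lambda>j. inv (z j)) ` {..<N}"
  have F: "finite F" "F \<subseteq> carrier G" using z(1) by (auto simp: F_def)
  have "x \<in> (\<Union>g\<in>F. g <# X)" if x: "x \<in> carrier G" for x
  proof -
    obtain j where j: "j < N" "z j \<otimes> x \<in> X" using z(2) x by blast
    have "x = inv (z j) \<otimes> (z j \<otimes> x)" using z(1) x by (simp add: m_assoc[symmetric])
    then show ?thesis using j unfolding l_coset_def F_def by blast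
  qed
  moreover have "g <# X \<subseteq> carrier G" if "g \<in> F" for g
    using that F(2) assms unfolding l_coset_def by auto
  ultimately have "carrier G = (\<Union>g\<in>F. g <# X)" by blast
  then show "generic_set G X" unfolding generic_set_def using F by blast
qed

lemma covers_mono_set: "covers G N X \<Longrightarrow> X \<subseteq> Y \<Longrightarrow> covers G N Y"
  unfolding covers_def by blast

lemma generic_set_mono:
  "\<lbrakk>generic_set G X; X \<subseteq> Y; Y \<subseteq> carrier G\<rbrakk> \<Longrightarrow> generic_set G Y"
  using generic_set_iff_covers covers_mono_set by (meson order_trans)

lemma generic_set_carrier: "generic_set G (carrier G)"
proof -
  have "covers G 1 (carrier G)"
    unfolding covers_def by (intro exI[of _ "\<lambda>_. \<one>"]) auto
  then show ?thesis using generic_set_iff_covers by blast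
qed

lemma not_generic_set_empty: "\<not> generic_set G {}"
  using one_closed generic_set_iff_covers[of "{}"] unfolding covers_def by blast

end

section \<open>Definable sets and stability\<close>

lemma holds_singleton: "\<phi> \<in> fmls 1 A \<Longrightarrow> holds G [x] \<phi> \<longleftrightarrow> sat G (\<lambda>_. x) \<phi>"
  by (rule sat_cong) (auto simp: fmls_def)

text \<open>This makes a fibre of a formula in several variables the solution set of a formula in
  one variable: the other variables are frozen at their values, which become parameters.\<close>

lemma close_formula:
  "\<exists>\<psi>\<in>fmls 1 (params \<phi> \<union> e ` (fv \<phi> - {v})). \<forall>x. sat G (\<lambda>_. x) \<psi> \<longleftrightarrow> sat G (e(v := x)) \<phi>"
proof -
  define \<sigma> where "\<sigma> i = (if i = v then Var 0 else Const (e i))" for i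
  have "sat G (\<lambda>_. x) (subst 1 \<sigma> Const \<phi>) \<longleftrightarrow> sat G (e(v := x)) \<phi>" for x
  proof -
    have "sat G (\<lambda>_. x) (subst 1 \<sigma> Const \<phi>) \<longleftrightarrow>
        sat G (\<lambda>i. eval_trm G (\<lambda>_. x) (\<sigma> i)) \<phi>"
      by (rule sat_subst) (auto simp: \<sigma>_def)
    also have "(\<lambda>i. eval_trm G (\<lambda>_. x) (\<sigma> i)) = e(v := x)"
      by (auto simp: \<sigma>_def)
    finally show ?thesis .
  qed
  moreover have "subst 1 \<sigma> Const \<phi> \<in> fmls 1 (params \<phi> \<union> e ` (fv \<phi> - {v}))"
    by (rule subst_in_fmls) (auto simp: \<sigma>_def)
  ultimately show ?thesis by blast
qed

section \<open>Definable sets, and the consequences of stability for their translates\<close>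

context stable_comm_group
begin

text \<open>Meant for formulas in the variable 0 alone, for which a constant assignment replaces the
  list \<open>[x]\<close>.\<close>

definition dset :: "('a, 'r) fm \<Rightarrow> 'a set" where
  "dset \<phi> = {x \<in> carrier G. sat G (\<lambda>_. x) \<phi>}"

definition definable :: "'a set \<Rightarrow> bool" where
  "definable X \<longleftrightarrow> (\<exists>\<phi>\<in>fmls 1 (carrier G). X = dset \<phi>)"

lemma dset_subset: "dset \<phi> \<subseteq> carrier G"
  by (auto simp: dset_def)

lemma definable_subset: "definable X \<Longrightarrow> X \<subseteq> carrier G"
  by (auto simp: definable_def dset_def)

lemma definable_dset: "\<phi> \<in> fmls 1 A \<Longrightarrow> A \<subseteq> carrier G \<Longrightarrow> definable (dset \<phi>)"
  unfolding definable_def using fmls_mono by blast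

lemma dset_Neg: "dset (Neg \<phi>) = carrier G - dset \<phi>"
  by (auto simp: dset_def)

lemma dset_Conj: "dset (Conj \<phi> \<psi>) = dset \<phi> \<inter> dset \<psi>"
  by (auto simp: dset_def)

lemma definable_Diff: "definable X \<Longrightarrow> definable (carrier G - X)"
  unfolding definable_def by (metis dset_Neg Neg_fmls_iff)

lemma definable_Int: "definable X \<Longrightarrow> definable Y \<Longrightarrow> definable (X \<inter> Y)"
  unfolding definable_def by (metis dset_Conj Conj_fmls_iff)

lemma definable_Un:
  assumes "definable X" "definable Y"
  shows "definable (X \<union> Y)"
proof -
  have "X \<union> Y = carrier G - ((carrier G - X) \<inter> (carrier G - Y))"
    using assms definable_subset by blast
  then show ?thesis using assms definable_Diff definable_Int by simp
qed

lemma definable_carrier: "definable (carrier G)"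
proof -
  have "Eq (Var 0) (Var 0) \<in> (fmls 1 (carrier G) :: ('a, 'r) fm set)"
    by (auto simp: fmls_def)
  moreover have "carrier G = dset (Eq (Var 0) (Var 0))" by (auto simp: dset_def)
  ultimately show ?thesis unfolding definable_def by blast
qed

lemma definable_fiber:
  assumes "params \<phi> \<subseteq> carrier G" "\<And>i. i \<in> fv \<phi> \<Longrightarrow> i \<noteq> v \<Longrightarrow> e i \<in> carrier G"
  shows "definable {x \<in> carrier G. sat G (e(v := x)) \<phi>}"
proof -
  obtain \<psi> where \<psi>: "\<psi> \<in> fmls 1 (params \<phi> \<union> e ` (fv \<phi> - {v}))"
    "\<forall>x. sat G (\<lambda>_. x) \<psi> \<longleftrightarrow> sat G (e(v := x)) \<phi>"
    using close_formula[of \<phi> e v G] by blast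
  have "params \<phi> \<union> e ` (fv \<phi> - {v}) \<subseteq> carrier G" using assms by auto
  with \<psi>(1) have "definable (dset \<psi>)" by (rule definable_dset)
  then show ?thesis unfolding dset_def \<psi>(2)[rule_format] .
qed

lemma definable_translate:
  assumes "definable X" "c \<in> carrier G"
  shows "definable {x \<in> carrier G. c \<otimes> x \<in> X}"
proof -
  obtain \<phi> where \<phi>: "\<phi> \<in> fmls 1 (carrier G)" "X = dset \<phi>"
    using assms(1) unfolding definable_def by blast
  define \<sigma> where "\<sigma> i = (if i = 0 then Mult (Const c) (Var 0) else Var (1 + i))" for i :: nat
  have "sat G (\<lambda>_. x) (subst 1 \<sigma> Const \<phi>) \<longleftrightarrow> sat G (\<lambda>_. c \<otimes> x) \<phi>" for x
  proof -
    have "sat G (\<lambda>_. x) (subst 1 \<sigma> Const \<phi>) \<longleftrightarrow>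
        sat G (\<lambda>i. eval_trm G (\<lambda>_. x) (\<sigma> i)) \<phi>"
      by (rule sat_subst) (auto simp: \<sigma>_def)
    also have "\<dots> \<longleftrightarrow> sat G (\<lambda>_. c \<otimes> x) \<phi>"
      using \<phi>(1) by (intro sat_cong) (auto simp: \<sigma>_def fmls_def)
    finally show ?thesis .
  qed
  then have "{x \<in> carrier G. c \<otimes> x \<in> X} = dset (subst 1 \<sigma> Const \<phi>)"
    using assms(2) \<phi>(2) by (auto simp: dset_def)
  moreover have "subst 1 \<sigma> Const \<phi> \<in> fmls 1 (carrier G)"
    using \<phi>(1) assms(2) by (intro subst_in_fmls) (auto simp: \<sigma>_def fmls_def)
  ultimately show ?thesis unfolding definable_def by blast
qed

text \<open>The order property speaks of formulas without parameters, so both the translating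
  element and the parameters of \<open>X\<close> are made variables.\<close>

lemma translate_formula:
  assumes "definable X"
  obtains \<theta> d where "\<theta> \<in> fmls (1 + (1 + length d)) {}" "set d \<subseteq> carrier G"
    "\<forall>x\<in>carrier G. \<forall>c\<in>carrier G. holds G ([x] @ (c # d)) \<theta> \<longleftrightarrow> c \<otimes> x \<in> X"
proof -
  obtain \<phi> where \<phi>: "\<phi> \<in> fmls 1 (carrier G)" "X = dset \<phi>"
    using assms(1) unfolding definable_def by blast
  obtain d where d: "set d = params \<phi>" using finite_list[OF finite_params[of \<phi>]] by (elim exE)
  have "\<forall>a\<in>set d. \<exists>i<length d. d ! i = a" by (simp add: in_set_conv_nth)
  then obtain idx where idx: "\<forall>a\<in>set d. idx a < length d \<and> d ! idx a = a" by metis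
  \<comment> \<open>Position 0 holds the point, position 1 the translating element, and the
    positions from 2 on the parameters; \<open>K\<close> is the first free one.\<close>
  define K where "K = 2 + length d"
  define \<sigma> :: "nat \<Rightarrow> 'a trm" where
    "\<sigma> i = (if i = 0 then Mult (Var 1) (Var 0) else Var (K + i))" for i
  define \<tau> :: "'a \<Rightarrow> 'a trm" where "\<tau> a = Var (2 + idx a)" for a
  have "holds G ([x] @ (c # d)) (subst K \<sigma> \<tau> \<phi>) \<longleftrightarrow> c \<otimes> x \<in> X"
    if "x \<in> carrier G" "c \<in> carrier G" for x c
  proof -
    have "holds G ([x] @ (c # d)) (subst K \<sigma> \<tau> \<phi>) \<longleftrightarrow>
        sat G (\<lambda>i. eval_trm G ((!) ([x] @ (c # d))) (\<sigma> i)) \<phi>"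
    proof (rule sat_subst)
      show "fv_trm (\<sigma> i) \<subseteq> {..<K} \<union> {K + i}" for i
        by (auto simp: \<sigma>_def K_def)
      show "fv_trm (\<tau> a) \<subseteq> {..<K}" if "a \<in> params \<phi>" for a
        using idx d that by (auto simp: \<tau>_def K_def)
      show "eval_trm G ((!) ([x] @ (c # d))) (\<tau> a) = a" if "a \<in> params \<phi>" for a
        using idx d that by (auto simp: \<tau>_def)
    qed
    also have "\<dots> \<longleftrightarrow> sat G (\<lambda>_. c \<otimes> x) \<phi>"
      using \<phi>(1) by (intro sat_cong) (auto simp: \<sigma>_def fmls_def)
    also have "\<dots> \<longleftrightarrow> c \<otimes> x \<in> X" using that \<phi>(2) by (simp add: dset_def)
    finally show ?thesis .
  qed
  moreover have "subst K \<sigma> \<tau> \<phi> \<in> fmls (1 + (1 + length d)) {}"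
    using \<phi>(1) d idx by (intro subst_in_fmls) (auto simp: \<sigma>_def \<tau>_def fmls_def)
  moreover have "set d \<subseteq> carrier G" using \<phi>(1) d by (auto simp: fmls_def)
  ultimately show ?thesis by (intro that[of "subst K \<sigma> \<tau> \<phi>" d]) auto
qed

text \<open>A next term can fail to exist only if every \<open>r\<close> has
  \<open>r \<otimes> w \<in> X\<close> for some \<open>w\<close> among the finitely many
  \<open>W T\<close>. By commutativity these \<open>w\<close> would witness that \<open>X\<close> is
  generic.\<close>

lemma avoiding_sequence:
  assumes "X \<subseteq> carrier G" "\<not> generic_set G X" "\<And>T. W T \<in> carrier G"
  shows "\<exists>c::nat \<Rightarrow> 'a. \<forall>n. c n \<in> carrier G \<and> (\<forall>T\<subseteq>c ` {..<n}. c n \<otimes> W T \<notin> X)"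
proof (rule dependent_wellorder_choice)
  fix r and f g :: "nat \<Rightarrow> 'a" and n
  assume "\<And>y. y < n \<Longrightarrow> f y = g y"
  then have "f ` {..<n} = g ` {..<n}" by auto
  then show "(r \<in> carrier G \<and> (\<forall>T\<subseteq>f ` {..<n}. r \<otimes> W T \<notin> X)) =
      (r \<in> carrier G \<and> (\<forall>T\<subseteq>g ` {..<n}. r \<otimes> W T \<notin> X))" by simp
next
  fix n and f :: "nat \<Rightarrow> 'a"
  define F where "F = W ` Pow (f ` {..<n})"
  have F: "finite F" "F \<subseteq> carrier G" using assms(3) by (auto simp: F_def)
  show "\<exists>r. r \<in> carrier G \<and> (\<forall>T\<subseteq>f ` {..<n}. r \<otimes> W T \<notin> X)"
  proof (rule ccontr)
    assume "\<not> ?thesis"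
    then have ex: "\<exists>w\<in>F. r \<otimes> w \<in> X" if "r \<in> carrier G" for r
      using that unfolding F_def by blast
    obtain h and N :: nat where h: "F = h ` {..<N}"
      using F(1) by (metis finite_imp_nat_seg_image_inj_on lessThan_def)
    define z where "z j = (if j < N then h j else \<one>)" for j
    have "z j \<in> carrier G" for j using F(2) h by (auto simp: z_def)
    moreover have "\<exists>j<N. z j \<otimes> x \<in> X" if x: "x \<in> carrier G" for x
    proof -
      obtain j where j: "j < N" "x \<otimes> h j \<in> X" using ex[OF x] h by auto
      moreover have "h j \<in> carrier G" using j h F(2) by auto
      ultimately have "z j \<otimes> x \<in> X" using m_comm[of "h j" x] x by (simp add: z_def)
      then show ?thesis using j(1) by blast
    qed
    ultimately have "covers G N X" unfolding covers_def by blast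
    then show False using assms generic_set_iff_covers by blast
  qed
qed

text \<open>
  The sequence avoids, at each step, a chosen common point of every consistent finite set of earlier
  translates. If \<open>k\<close> of its translates had a common point, then the chosen points for the initial
  segments of these \<open>k\<close> translates would form a ladder of length \<open>k\<close>.
\<close>

lemma nongeneric_translates:
  assumes "definable X" "\<not> generic_set G X"
  obtains c :: "nat \<Rightarrow> 'a" and k where "\<forall>n. c n \<in> carrier G"
    "\<forall>K x. finite K \<and> card K = k \<and> x \<in> carrier G \<longrightarrow> (\<exists>n\<in>K. c n \<otimes> x \<notin> X)"
proof -
  define W where
    "W T = (if \<exists>x\<in>carrier G. \<forall>t\<in>T. t \<otimes> x \<in> X
       then SOME x. x \<in> carrier G \<and> (\<forall>t\<in>T. t \<otimes> x \<in> X) else \<one>)" for T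
  have W: "W T \<in> carrier G \<and> (\<forall>t\<in>T. t \<otimes> W T \<in> X)"
    if "x \<in> carrier G" "\<forall>t\<in>T. t \<otimes> x \<in> X" for T x
  proof -
    have "W T = (SOME x. x \<in> carrier G \<and> (\<forall>t\<in>T. t \<otimes> x \<in> X))"
      using that unfolding W_def by (intro if_P) blast
    then show ?thesis
      using someI[of "\<lambda>x. x \<in> carrier G \<and> (\<forall>t\<in>T. t \<otimes> x \<in> X)" x] that by simp
  qed
  have "W T \<in> carrier G" for T
  proof (cases "\<exists>x\<in>carrier G. \<forall>t\<in>T. t \<otimes> x \<in> X")
    case True
    then show ?thesis using W by blast
  next
    case False
    then have "W T = \<one>" unfolding W_def by (rule if_not_P)
    then show ?thesis by simp
  qed
  then obtain c :: "nat \<Rightarrow> 'a" where c: "\<And>n. c n \<in> carrier G"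
    "\<And>n T. T \<subseteq> c ` {..<n} \<Longrightarrow> c n \<otimes> W T \<notin> X"
    using avoiding_sequence[of X W] assms definable_subset by metis
  obtain \<theta> d where \<theta>: "\<theta> \<in> fmls (1 + (1 + length d)) {}" "set d \<subseteq> carrier G"
    "\<forall>x\<in>carrier G. \<forall>c\<in>carrier G. holds G ([x] @ (c # d)) \<theta> \<longleftrightarrow> c \<otimes> x \<in> X"
    using translate_formula[OF assms(1)] .
  \<comment> \<open>Membership fails exactly for \<open>i < j\<close>, so the ladder is one for the
    negation.\<close>
  have "Neg \<theta> \<in> fmls (1 + (1 + length d)) {}" using \<theta>(1) by simp
  then obtain k where k: "\<not> ladder G 1 (1 + length d) (Neg \<theta>) k"
    using stable unfolding stable_theory_def by blast
  have "\<exists>n\<in>K. c n \<otimes> x \<notin> X" if K: "finite K" "card K = k" and x: "x \<in> carrier G" for K x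
  proof (rule ccontr)
    assume "\<not> ?thesis"
    then have xK: "\<forall>n\<in>K. c n \<otimes> x \<in> X" by blast
    \<comment> \<open>An increasing enumeration makes the points chosen for initial segments of
      \<open>K\<close> subject to avoidance by the later terms. The segments are consistent because
      of \<open>x\<close>.\<close>
    obtain h where h: "bij_betw h {..<k} K" "strict_mono_on {..<k} h"
      using ex_bij_betw_strict_mono_card[OF K(1)] K(2) by metis
    define w where "w i = W (c ` h ` {..i})" for i
    have w: "w i \<in> carrier G" "\<forall>j\<le>i. c (h j) \<otimes> w i \<in> X" if "i < k" for i
    proof -
      have "\<forall>t\<in>c ` h ` {..i}. t \<otimes> x \<in> X"
        using xK h(1) that by (auto simp: bij_betw_def)
      from W[OF x this] show "w i \<in> carrier G" "\<forall>j\<le>i. c (h j) \<otimes> w i \<in> X"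
        by (auto simp: w_def)
    qed
    have "c (h j) \<otimes> w i \<notin> X" if "i < j" "j < k" for i j
    proof -
      have "h l < h j" if "l \<le> i" for l
        using strict_mono_onD[OF h(2)] that \<open>i < j\<close> \<open>j < k\<close> by simp
      then have "c ` h ` {..i} \<subseteq> c ` {..<h j}" by auto
      from c(2)[OF this] show ?thesis by (simp add: w_def)
    qed
    then have "c (h j) \<otimes> w i \<in> X \<longleftrightarrow> \<not> i < j" if "i < k" "j < k" for i j
      using w(2)[OF that(1)] that by (meson not_le)
    then have "ladder G 1 (1 + length d) (Neg \<theta>) k"
      unfolding ladder_def using w(1) c(1) \<theta>(2,3)
      by (intro exI[of _ "\<lambda>i. [w i]"] exI[of _ "\<lambda>j. c (h j) # d"]) (auto simp: tuples_def)
    then show False using k by blast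
  qed
  then show ?thesis using c(1) by (intro that[of c k]) auto
qed

text \<open>If \<open>Y\<close> is not generic, some \<open>k\<close> of its translates have no
  common point. Every \<open>x\<close> misses one of them and so lies in the corresponding translate
  of \<open>X\<close>.\<close>

lemma generic_set_cases:
  assumes "definable X" "definable Y" "X \<union> Y = carrier G"
  shows "generic_set G X \<or> generic_set G Y"
proof (rule disjCI)
  assume "\<not> generic_set G Y"
  then obtain c :: "nat \<Rightarrow> 'a" and k where c: "\<forall>n. c n \<in> carrier G"
    "\<forall>K x. finite K \<and> card K = k \<and> x \<in> carrier G \<longrightarrow> (\<exists>n\<in>K. c n \<otimes> x \<notin> Y)"
    using nongeneric_translates[OF assms(2)] by blast
  have "\<exists>j<k. c j \<otimes> x \<in> X" if x: "x \<in> carrier G" for x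
  proof -
    obtain j where "j < k" "c j \<otimes> x \<notin> Y"
      using c(2)[rule_format, of "{..<k}" x] x by auto
    moreover have "c j \<otimes> x \<in> X \<union> Y" using c(1) x assms(3) by simp
    ultimately show ?thesis by blast
  qed
  then have "covers G k X" unfolding covers_def using c(1) by blast
  then show "generic_set G X" using generic_set_iff_covers definable_subset[OF assms(1)] by blast
qed

lemma definable_translates_Un:
  assumes "definable X" "\<And>j. z j \<in> carrier G"
  shows "definable {x \<in> carrier G. \<exists>j<N::nat. z j \<otimes> x \<in> X}"
proof (induction N)
  case 0
  show ?case using definable_Diff[OF definable_carrier] by simp
next
  case (Suc N)
  have "{x \<in> carrier G. \<exists>j<Suc N. z j \<otimes> x \<in> X} =
      {x \<in> carrier G. \<exists>j<N. z j \<otimes> x \<in> X} \<union> {x \<in> carrier G. z N \<otimes> x \<in> X}"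
    by (auto simp: less_Suc_eq)
  then show ?case using Suc definable_Un definable_translate assms by simp
qed

lemma generic_translates_UnD:
  assumes "X \<subseteq> carrier G" "\<And>j. z j \<in> carrier G"
    and "generic_set G {x \<in> carrier G. \<exists>j<N::nat. z j \<otimes> x \<in> X}"
  shows "generic_set G X"
proof -
  obtain M where "covers G M {x \<in> carrier G. \<exists>j<N. z j \<otimes> x \<in> X}"
    using assms(3) generic_set_iff_covers[of "{x \<in> carrier G. \<exists>j<N. z j \<otimes> x \<in> X}"] by auto
  then obtain y where y: "\<forall>i. y i \<in> carrier G"
    "\<forall>x\<in>carrier G. \<exists>i<M. y i \<otimes> x \<in> {x \<in> carrier G. \<exists>j<N. z j \<otimes> x \<in> X}"
    unfolding covers_def by (elim exE conjE)
  \<comment> \<open>The pair of indices \<open>i < M\<close> and \<open>j < N\<close> is coded as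
    \<open>i * N + j\<close>.\<close>
  define u where "u l = z (l mod N) \<otimes> y (l div N)" for l
  have "\<exists>l<M * N. u l \<otimes> x \<in> X" if x: "x \<in> carrier G" for x
  proof -
    obtain i j where ij: "i < M" "j < N" "z j \<otimes> (y i \<otimes> x) \<in> X" using y(2) x by blast
    have "u (i * N + j) \<otimes> x = z j \<otimes> (y i \<otimes> x)"
      using ij(2) x y(1) assms(2) by (simp add: u_def m_assoc)
    moreover have "i * N + j < M * N"
    proof -
      have "i * N + j < Suc i * N" using ij(2) by simp
      also have "\<dots> \<le> M * N" using ij(1) by (intro mult_le_mono1) simp
      finally show ?thesis .
    qed
    ultimately show ?thesis using ij(3) by (intro exI[of _ "i * N + j"]) simp
  qed
  moreover have "u l \<in> carrier G" for l using y(1) assms(2) by (simp add: u_def)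
  ultimately have "covers G (M * N) X" unfolding covers_def by blast
  then show ?thesis using generic_set_iff_covers assms(1) by blast
qed

text \<open>Finitely many translates of the union cover \<open>G\<close>. Grouping them into
  translates of \<open>X\<close> and translates of \<open>Y\<close> reduces the claim to two sets
  with union \<open>G\<close>.\<close>

lemma generic_set_UnD:
  assumes "definable X" "definable Y" "generic_set G (X \<union> Y)"
  shows "generic_set G X \<or> generic_set G Y"
proof -
  have XY: "X \<subseteq> carrier G" "Y \<subseteq> carrier G" using assms(1,2) definable_subset by auto
  then obtain N where "covers G N (X \<union> Y)"
    using assms(3) generic_set_iff_covers[of "X \<union> Y"] by auto
  then obtain z where z: "\<forall>j. z j \<in> carrier G" "\<forall>x\<in>carrier G. \<exists>j<N. z j \<otimes> x \<in> X \<union> Y"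
    unfolding covers_def by (elim exE conjE)
  have "{x \<in> carrier G. \<exists>j<N. z j \<otimes> x \<in> X} \<union> {x \<in> carrier G. \<exists>j<N. z j \<otimes> x \<in> Y} = carrier G"
    using z(2) by blast
  then have "generic_set G {x \<in> carrier G. \<exists>j<N. z j \<otimes> x \<in> X} \<or>
      generic_set G {x \<in> carrier G. \<exists>j<N. z j \<otimes> x \<in> Y}"
    using generic_set_cases definable_translates_Un assms(1,2) z(1) by simp
  then show ?thesis
    using generic_translates_UnD[OF XY(1), of z N] generic_translates_UnD[OF XY(2), of z N] z(1)
    by blast
qed

lemma definable_UNION:
  "finite I \<Longrightarrow> (\<And>i. i \<in> I \<Longrightarrow> definable (X i)) \<Longrightarrow> definable (\<Union>i\<in>I. X i)"
proof (induction I rule: finite_induct)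
  case empty
  show ?case using definable_Diff[OF definable_carrier] by simp
qed (simp add: definable_Un)

lemma generic_set_UNIOND:
  "\<lbrakk>finite I; \<And>i. i \<in> I \<Longrightarrow> definable (X i); generic_set G (\<Union>i\<in>I. X i)\<rbrakk>
    \<Longrightarrow> \<exists>i\<in>I. generic_set G (X i)"
proof (induction I rule: finite_induct)
  case empty
  then show ?case using not_generic_set_empty by simp
next
  case (insert i I)
  then have "generic_set G (X i) \<or> generic_set G (\<Union>i\<in>I. X i)"
    using generic_set_UnD[of "X i" "\<Union>i\<in>I. X i"] definable_UNION[of I X] by simp
  then show ?case using insert by auto
qed

end

section \<open>Generic types do not fork\<close>

context stable_comm_group
begin

text \<open>For fixed \<open>N\<close> the condition is first order: \<open>N\<close> existential
  quantifiers over translating elements, a universal one over the covered point, and a finite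
  disjunction.\<close>

lemma covering_formula:
  assumes \<phi>: "\<phi> \<in> fmls (Suc m) {}"
  shows "\<exists>\<theta>\<in>fmls m {}. \<forall>e. sat G e \<theta> \<longleftrightarrow> covers G N {x \<in> carrier G. sat G (e(m := x)) \<phi>}"
proof -
  \<comment> \<open>Positions below \<open>m\<close> hold the parameters, those from
    \<open>m\<close> to \<open>m + N - 1\<close> the translating elements, and \<open>m + N\<close>
    the point to be covered. The point variable \<open>m\<close> of \<open>\<phi>\<close> is
    replaced by the \<open>j\<close>-th product.\<close>
  define \<sigma> :: "nat \<Rightarrow> nat \<Rightarrow> 'a trm" where
    "\<sigma> j i = (if i < m then Var i else if i = m then Mult (Var (m + j)) (Var (m + N))
      else Var (Suc (m + N) + i))" for j i
  define \<delta> where "\<delta> j = subst (Suc (m + N)) (\<sigma> j) Const \<phi>" for j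
  have \<delta>: "sat G e (\<delta> j) \<longleftrightarrow> sat G (e(m := e (m + j) \<otimes> e (m + N))) \<phi>" if "j < N" for e j
  proof -
    have "sat G e (\<delta> j) \<longleftrightarrow> sat G (\<lambda>i. eval_trm G e (\<sigma> j i)) \<phi>"
      unfolding \<delta>_def using that by (intro sat_subst) (auto simp: \<sigma>_def)
    also have "\<dots> \<longleftrightarrow> sat G (e(m := e (m + j) \<otimes> e (m + N))) \<phi>"
      using \<phi> by (intro sat_cong) (auto simp: \<sigma>_def fmls_def)
    finally show ?thesis .
  qed
  have "\<delta> j \<in> fmls (Suc (m + N)) {}" if "j < N" for j
    unfolding \<delta>_def using \<phi> that by (intro subst_in_fmls) (auto simp: \<sigma>_def fmls_def)
  then have "\<delta> ` {..<N} \<subseteq> fmls (Suc (m + N)) {}" by auto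
  from finite_disj_formula[OF _ this, of G] obtain D where
    D: "D \<in> fmls (Suc (m + N)) {}" "\<forall>e. sat G e D \<longleftrightarrow> (\<exists>\<phi>\<in>\<delta> ` {..<N}. sat G e \<phi>)" by auto
  define \<chi> where "\<chi> = Neg (Ex (m + N) (Neg D))"
  have "\<chi> \<in> fmls (m + N) {}" using D(1) by (auto simp: \<chi>_def fmls_def less_Suc_eq)
  from Ex_tuple_formula[OF _ this] one_closed obtain \<theta> where \<theta>: "\<theta> \<in> fmls m {}"
    "\<forall>e. sat G e \<theta> \<longleftrightarrow>
      (\<exists>z. (\<forall>j. z j \<in> carrier G) \<and> sat G (\<lambda>i. if i < m then e i else z (i - m)) \<chi>)" by blast
  have "sat G (\<lambda>i. if i < m then e i else z (i - m)) \<chi> \<longleftrightarrow>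
      (\<forall>x\<in>carrier G. \<exists>j<N. z j \<otimes> x \<in> {x \<in> carrier G. sat G (e(m := x)) \<phi>})"
    if z: "\<forall>j. z j \<in> carrier G" for e z
  proof -
    define e' where "e' = (\<lambda>i. if i < m then e i else z (i - m))"
    have "sat G (e'(m + N := x)) (\<delta> j) \<longleftrightarrow> sat G (e(m := z j \<otimes> x)) \<phi>" if "j < N" for x j
      unfolding \<delta>[OF that] using \<phi> that
      by (intro sat_cong) (auto simp: e'_def fmls_def)
    then have "sat G (e'(m + N := x)) D \<longleftrightarrow> (\<exists>j<N. sat G (e(m := z j \<otimes> x)) \<phi>)" for x
      using D(2) by auto
    then show ?thesis
      unfolding \<chi>_def e'_def[symmetric] using z by simp
  qed
  then have "sat G e \<theta> \<longleftrightarrow> covers G N {x \<in> carrier G. sat G (e(m := x)) \<phi>}" for e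
    unfolding covers_def \<theta>(2)[rule_format] by (intro ex_cong1 conj_cong refl) simp
  then show ?thesis using \<theta>(1) by blast
qed

lemma definable_holds:
  assumes "\<phi> \<in> fmls (1 + length b) {}" "set b \<subseteq> carrier G"
  shows "definable {x \<in> carrier G. holds G ([x] @ b) \<phi>}"
proof -
  have "holds G ([x] @ b) \<phi> \<longleftrightarrow> sat G (((!) ([\<one>] @ b))(0 := x)) \<phi>" for x
    using assms(1) by (intro sat_cong) (auto simp: fmls_def nth_Cons split: nat.split)
  moreover have "definable {x \<in> carrier G. sat G (((!) ([\<one>] @ b))(0 := x)) \<phi>}"
    using assms by (intro definable_fiber) (auto simp: fmls_def nth_Cons subset_iff split: nat.splits)
  ultimately show ?thesis by simp
qed

text \<open>
  That finitely many translates of a set cover \<open>G\<close>, with a given bound on their number, is part of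
  the type of the parameters, so it holds for all conjugates; by double counting these are not
  \<open>k\<close>-inconsistent.
\<close>

lemma generic_not_divides:
  assumes \<phi>: "\<phi> \<in> fmls (1 + length b) {}"
    and gen: "generic_set G {x \<in> carrier G. holds G ([x] @ b) \<phi>}"
  shows "\<not> divides G A 1 \<phi> b"
proof
  assume "divides G A 1 \<phi> b"
  then obtain k and bs :: "nat \<Rightarrow> 'a list" where
    bs: "\<forall>i. bs i \<in> tuples G (length b) \<and> tp G (bs i) A = tp G b A"
    "\<forall>K. finite K \<and> card K = k \<longrightarrow> \<not> (\<exists>xs\<in>tuples G 1. \<forall>i\<in>K. holds G (xs @ bs i) \<phi>)"
    unfolding divides_def by (elim exE conjE)
  define m where "m = length b"
  have len: "length (bs i) = m" for i using bs(1) by (simp add: tuples_def m_def)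
  \<comment> \<open>\<open>\<phi>\<close> has its point variable at position 0, whereas
    \<open>covering_formula\<close> expects it at position \<open>m\<close>, after the
    parameters.\<close>
  define \<sigma> :: "nat \<Rightarrow> 'a trm" where
    "\<sigma> i = (if i = 0 then Var m else if i \<le> m then Var (i - 1) else Var (Suc m + i))" for i
  define \<phi>' where "\<phi>' = subst (Suc m) \<sigma> Const \<phi>"
  have \<phi>': "sat G (((!) c)(m := x)) \<phi>' \<longleftrightarrow> holds G ([x] @ c) \<phi>" if "length c = m" for c x
  proof -
    have "sat G (((!) c)(m := x)) \<phi>' \<longleftrightarrow>
        sat G (\<lambda>i. eval_trm G (((!) c)(m := x)) (\<sigma> i)) \<phi>"
      unfolding \<phi>'_def using \<phi> by (intro sat_subst) (auto simp: \<sigma>_def)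
    also have "\<dots> \<longleftrightarrow> holds G ([x] @ c) \<phi>"
      using \<phi> that
      by (intro sat_cong) (auto simp: \<sigma>_def fmls_def m_def nth_Cons split: nat.splits)
    finally show ?thesis .
  qed
  have "\<phi>' \<in> fmls (Suc m) {}"
    unfolding \<phi>'_def using \<phi> by (intro subst_in_fmls) (auto simp: \<sigma>_def fmls_def m_def)
  obtain N where N: "covers G N {x \<in> carrier G. holds G ([x] @ b) \<phi>}"
    using gen generic_set_iff_covers[of "{x \<in> carrier G. holds G ([x] @ b) \<phi>}"] by auto
  obtain \<theta> where \<theta>: "\<theta> \<in> fmls m {}"
    "\<forall>e. sat G e \<theta> \<longleftrightarrow> covers G N {x \<in> carrier G. sat G (e(m := x)) \<phi>'}"
    using covering_formula[OF \<open>\<phi>' \<in> fmls (Suc m) {}\<close>, of N] by blast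
  have \<theta>': "holds G c \<theta> \<longleftrightarrow> covers G N {x \<in> carrier G. holds G ([x] @ c) \<phi>}"
    if "length c = m" for c
    unfolding \<theta>(2)[rule_format] using \<phi>'[OF that] by simp
  have "\<theta> \<in> tp G b A"
    using \<theta>(1) \<theta>'[of b] N fmls_mono[of "{}" A m] by (auto simp: tp_def m_def)
  then have "\<theta> \<in> tp G (bs i) A" for i using bs(1) by simp
  then have cov: "covers G N {x \<in> carrier G. holds G ([x] @ bs i) \<phi>}" for i
    using \<theta>'[OF len] by (simp add: tp_def)
  have "0 < N" using N one_closed unfolding covers_def by (cases N) auto
  then obtain x where x: "x \<in> carrier G"
    "k \<le> card {i \<in> {..<2 * N * k}. x \<in> {x \<in> carrier G. holds G ([x] @ bs i) \<phi>}}"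
    using covers_common_point[of "{..<2 * N * k}" N
        "\<lambda>i. {x \<in> carrier G. holds G ([x] @ bs i) \<phi>}" k] cov by auto
  obtain K where K: "K \<subseteq> {i \<in> {..<2 * N * k}. x \<in> {x \<in> carrier G. holds G ([x] @ bs i) \<phi>}}"
    "card K = k" "finite K"
    using obtain_subset_with_card_n[OF x(2)] by blast
  have "[x] \<in> tuples G 1" using x(1) by (simp add: tuples_def)
  moreover have "\<forall>i\<in>K. holds G ([x] @ bs i) \<phi>" using K(1) by blast
  ultimately show False using bs(2) K(2,3) by blast
qed

text \<open>If a finite part of \<open>\<pi>\<close> implied finitely many dividing formulas in
  disjunction, one of these would be generic by \<open>generic_set_UNIOND\<close>, against
  \<open>generic_not_divides\<close>.\<close>

lemma generic_not_forks:
  assumes "\<And>F. finite F \<Longrightarrow> F \<subseteq> \<pi> \<Longrightarrow> generic_set G {x \<in> carrier G. \<forall>\<psi>\<in>F. holds G [x] \<psi>}"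
  shows "\<not> forks G A 1 \<pi>"
proof
  assume "forks G A 1 \<pi>"
  then obtain F \<Delta> where F: "finite F" "F \<subseteq> \<pi>" "finite \<Delta>"
    and \<Delta>: "\<forall>(\<phi>, b)\<in>\<Delta>. set b \<subseteq> carrier G \<and> \<phi> \<in> fmls (1 + length b) {} \<and> divides G A 1 \<phi> b"
    and imp: "\<forall>xs\<in>tuples G 1. (\<forall>\<psi>\<in>F. holds G xs \<psi>) \<longrightarrow> (\<exists>(\<phi>, b)\<in>\<Delta>. holds G (xs @ b) \<phi>)"
    unfolding forks_def by (elim exE conjE)
  define X where "X p = {x \<in> carrier G. holds G ([x] @ snd p) (fst p)}" for p
  have "{x \<in> carrier G. \<forall>\<psi>\<in>F. holds G [x] \<psi>} \<subseteq> (\<Union>p\<in>\<Delta>. X p)"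
  proof
    fix x
    assume x: "x \<in> {x \<in> carrier G. \<forall>\<psi>\<in>F. holds G [x] \<psi>}"
    then have "[x] \<in> tuples G 1" by (simp add: tuples_def)
    then have "\<exists>(\<phi>, b)\<in>\<Delta>. holds G ([x] @ b) \<phi>" using imp x by blast
    then obtain \<phi> b where "(\<phi>, b) \<in> \<Delta>" "holds G ([x] @ b) \<phi>" by blast
    then show "x \<in> (\<Union>p\<in>\<Delta>. X p)" using x by (intro UN_I[of "(\<phi>, b)"]) (auto simp: X_def)
  qed
  moreover have "(\<Union>p\<in>\<Delta>. X p) \<subseteq> carrier G" by (auto simp: X_def)
  ultimately have "generic_set G (\<Union>p\<in>\<Delta>. X p)"
    using generic_set_mono[OF assms[OF F(1,2)]] by simp
  moreover have \<Delta>': "set (snd p) \<subseteq> carrier G" "fst p \<in> fmls (1 + length (snd p)) {}"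
    "divides G A 1 (fst p) (snd p)" if "p \<in> \<Delta>" for p
    using bspec[OF \<Delta> that] by (simp_all add: case_prod_beta)
  then have "definable (X p)" if "p \<in> \<Delta>" for p
    unfolding X_def using that by (intro definable_holds)
  ultimately obtain p where p: "p \<in> \<Delta>" "generic_set G (X p)"
    using generic_set_UNIOND[OF F(3), of X] by blast
  then have "\<not> divides G A 1 (fst p) (snd p)"
    unfolding X_def using \<Delta>'(2) by (intro generic_not_divides)
  then show False using \<Delta>'(3) p(1) by blast
qed

section \<open>Sequences of generics\<close>

text \<open>A global generic type, represented by the definable sets that belong to it.\<close>

definition generic_ultrafilter :: "'a set set \<Rightarrow> bool" where
  "generic_ultrafilter P \<longleftrightarrow> (\<forall>X\<in>P. definable X) \<and>
     (\<forall>F. finite F \<and> F \<subseteq> P \<longrightarrow> generic_set G (carrier G \<inter> \<Inter>F)) \<and>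
     (\<forall>X. definable X \<longrightarrow> X \<in> P \<or> carrier G - X \<in> P)"

lemma definable_Inter:
  "finite F \<Longrightarrow> (\<And>X. X \<in> F \<Longrightarrow> definable X) \<Longrightarrow> definable (carrier G \<inter> \<Inter>F)"
proof (induction F rule: finite_induct)
  case empty
  show ?case using definable_carrier by simp
next
  case (insert X F)
  then have "definable (X \<inter> (carrier G \<inter> \<Inter>F))"
    using definable_Int[of X "carrier G \<inter> \<Inter>F"] by simp
  then show ?case by (simp add: Int_left_commute)
qed

text \<open>Zorn's lemma gives a maximal family with generic finite intersections. If it contained
  neither \<open>X\<close> nor its complement, finite subfamilies would obstruct adding either;
  their joint intersection \<open>D\<close> is generic, but \<open>X\<close> splits it into two sets
  that are not, against \<open>generic_set_UnD\<close>.\<close>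

lemma ex_generic_ultrafilter: "\<exists>P. generic_ultrafilter P"
proof -
  define \<A> where "\<A> = {P. (\<forall>X\<in>P. definable X) \<and>
    (\<forall>F. finite F \<and> F \<subseteq> P \<longrightarrow> generic_set G (carrier G \<inter> \<Inter>F))}"
  have "\<exists>M\<in>\<A>. \<forall>X\<in>\<A>. M \<subseteq> X \<longrightarrow> X = M"
  proof (rule subset_Zorn_nonempty)
    have "{} \<in> \<A>" using generic_set_carrier by (auto simp: \<A>_def)
    then show "\<A> \<noteq> {}" by blast
  next
    fix \<C>
    assume \<C>: "\<C> \<noteq> {}" "subset.chain \<A> \<C>"
    have "generic_set G (carrier G \<inter> \<Inter>F)" if F: "finite F" "F \<subseteq> \<Union>\<C>" for F
    proof -
      obtain P where "P \<in> \<C>" "F \<subseteq> P"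
        using finite_subset_Union_chain[OF F \<C>] by blast
      then show ?thesis using \<C>(2) F(1) by (auto simp: subset.chain_def \<A>_def)
    qed
    moreover have "definable X" if "X \<in> \<Union>\<C>" for X
      using that \<C>(2) by (auto simp: subset.chain_def \<A>_def)
    ultimately show "\<Union>\<C> \<in> \<A>" unfolding \<A>_def by simp
  qed
  then obtain M where M: "M \<in> \<A>" "\<And>P. P \<in> \<A> \<Longrightarrow> M \<subseteq> P \<Longrightarrow> P = M" by blast
  have M_def: "\<And>X. X \<in> M \<Longrightarrow> definable X"
    and M_gen: "\<And>F. finite F \<Longrightarrow> F \<subseteq> M \<Longrightarrow> generic_set G (carrier G \<inter> \<Inter>F)"
    using M(1) by (auto simp: \<A>_def)
  have ext: "\<exists>F. finite F \<and> F \<subseteq> M \<and> \<not> generic_set G (X \<inter> \<Inter>F)"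
    if X: "definable X" "X \<notin> M" for X
  proof -
    have "insert X M \<notin> \<A>" using M(2)[of "insert X M"] X(2) by blast
    then obtain F where F: "finite F" "F \<subseteq> insert X M" "\<not> generic_set G (carrier G \<inter> \<Inter>F)"
      using X(1) M_def unfolding \<A>_def by blast
    have "X \<inter> \<Inter>(F - {X}) \<subseteq> carrier G \<inter> \<Inter>F" using definable_subset[OF X(1)] by blast
    then have "\<not> generic_set G (X \<inter> \<Inter>(F - {X}))" using F(3) generic_set_mono by blast
    moreover have "finite (F - {X})" "F - {X} \<subseteq> M" using F(1,2) by auto
    ultimately show ?thesis by blast
  qed
  have "X \<in> M \<or> carrier G - X \<in> M" if X: "definable X" for X
  proof (rule ccontr)
    assume "\<not> ?thesis"
    then obtain F1 F2 where F: "finite F1" "F1 \<subseteq> M" "\<not> generic_set G (X \<inter> \<Inter>F1)"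
      "finite F2" "F2 \<subseteq> M" "\<not> generic_set G ((carrier G - X) \<inter> \<Inter>F2)"
      using ext[OF X] ext[OF definable_Diff[OF X]] by blast
    define D where "D = carrier G \<inter> \<Inter>(F1 \<union> F2)"
    have D: "generic_set G D" "definable D"
      unfolding D_def using F M_gen[of "F1 \<union> F2"] definable_Inter[of "F1 \<union> F2"] M_def by auto
    have "D = (D \<inter> X) \<union> (D \<inter> (carrier G - X))" by (auto simp: D_def)
    then have "generic_set G (D \<inter> X) \<or> generic_set G (D \<inter> (carrier G - X))"
      using generic_set_UnD[of "D \<inter> X" "D \<inter> (carrier G - X)"] D X definable_Int definable_Diff
      by metis
    moreover have "D \<inter> X \<subseteq> X \<inter> \<Inter>F1" "D \<inter> (carrier G - X) \<subseteq> (carrier G - X) \<inter> \<Inter>F2"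
      by (auto simp: D_def)
    moreover have "X \<inter> \<Inter>F1 \<subseteq> carrier G" "(carrier G - X) \<inter> \<Inter>F2 \<subseteq> carrier G"
      using definable_subset[OF X] by auto
    ultimately show False using F(3,6) generic_set_mono by meson
  qed
  then have "generic_ultrafilter M" unfolding generic_ultrafilter_def using M_def M_gen by blast
  then show ?thesis by blast
qed

text \<open>A weak form of a Morley sequence. The common type over the empty set is what
  \<open>divides\<close> asks of its parameters; genericity over the earlier terms gives
  independence and keeps the terms in distinct cosets.\<close>

definition generic_sequence :: "(nat \<Rightarrow> 'a) \<Rightarrow> bool" where
  "generic_sequence g \<longleftrightarrow> (\<forall>n. g n \<in> carrier G \<and> tp G [g n] {} = tp G [g 0] {} \<and>
     (\<forall>\<phi>\<in>fmls 1 (g ` {..<n}). sat G (\<lambda>_. g n) \<phi> \<longrightarrow> generic_set G (dset \<phi>)))"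

lemma generic_tp_not_forks:
  assumes "\<And>\<phi>. \<phi> \<in> fmls 1 C \<Longrightarrow> sat G (\<lambda>_. a) \<phi> \<Longrightarrow> generic_set G (dset \<phi>)"
  shows "\<not> forks G A 1 (tp G [a] C)"
proof (rule generic_not_forks)
  fix F assume F: "finite F" "F \<subseteq> tp G [a] C"
  then have F_fmls: "F \<subseteq> fmls 1 C" by (auto simp: tp_def)
  obtain \<psi> where \<psi>: "\<psi> \<in> fmls 1 C" "\<forall>e. sat G e \<psi> \<longleftrightarrow> (\<forall>\<phi>\<in>F. sat G e \<phi>)"
    using finite_conj_formula[OF F(1) F_fmls, of G] by auto
  have hs: "\<forall>\<phi>\<in>F. holds G [x] \<phi> \<longleftrightarrow> sat G (\<lambda>_. x) \<phi>" for x
    using F_fmls by (intro ballI holds_singleton[of _ C]) blast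
  have "\<forall>\<phi>\<in>F. holds G [a] \<phi>" using F(2) by (auto simp: tp_def)
  then have "sat G (\<lambda>_. a) \<psi>" using hs \<psi>(2) by blast
  then have "generic_set G (dset \<psi>)" using assms \<psi>(1) by blast
  moreover have "dset \<psi> = {x \<in> carrier G. \<forall>\<psi>\<in>F. holds G [x] \<psi>}"
    unfolding dset_def \<psi>(2)[rule_format] using hs by blast
  ultimately show "generic_set G {x \<in> carrier G. \<forall>\<psi>\<in>F. holds G [x] \<psi>}" by simp
qed

lemma generic_sequence_not_forks:
  assumes "generic_sequence g" "C \<subseteq> g ` {..<n}"
  shows "\<not> forks G A 1 (tp G [g n] C)"
proof (rule generic_tp_not_forks)
  fix \<phi> :: "('a, 'r) fm"
  assume "\<phi> \<in> fmls 1 C" "sat G (\<lambda>_. g n) \<phi>"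
  then show "generic_set G (dset \<phi>)"
    using assms(1) fmls_mono[OF assms(2)] unfolding generic_sequence_def by blast
qed

text \<open>
  The formulas of positive density: any sufficiently many translates of the solution set in a power
  of \<open>G\<close> include \<open>k\<close> with a common point.
\<close>

definition positive :: "('a, 'r) fm \<Rightarrow> bool" where
  "positive \<phi> \<longleftrightarrow> (\<forall>k. \<exists>M. \<forall>c. (\<forall>i j. c i j \<in> carrier G) \<longrightarrow>
     (\<exists>K u. K \<subseteq> {..<M::nat} \<and> card K = k \<and> (\<forall>j. u j \<in> carrier G) \<and>
        (\<forall>i\<in>K. sat G (\<lambda>j::nat. c i j \<otimes> u j) \<phi>)))"

text \<open>By induction on the number of variables. The fibre of \<open>\<phi>\<close> over the
  earlier terms is generic, hence covered by \<open>N\<close> translates, and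
  \<open>\<theta>\<close> expresses this bound with one variable fewer. Among enough translates of
  \<open>\<theta>\<close>, some \<open>2 * N * k\<close> share a point;
  \<open>covers_common_point\<close> then finds \<open>k\<close> fibres over it with a common last
  coordinate.\<close>

lemma generic_sequence_positive:
  assumes g: "generic_sequence g" and "\<phi> \<in> fmls n {}" "sat G g \<phi>"
  shows "positive \<phi>"
  using assms(2,3)
proof (induction n arbitrary: \<phi>)
  case 0
  have "sat G e \<phi>" for e
    using 0 sat_cong[of \<phi> e g G] by (auto simp: fmls_def)
  then have "\<exists>K u. K \<subseteq> {..<k} \<and> card K = k \<and> (\<forall>j. u j \<in> carrier G) \<and>
        (\<forall>i\<in>K. sat G (\<lambda>j. c i j \<otimes> u j) \<phi>)" for k c
    by (intro exI[of _ "{..<k}"] exI[of _ "\<lambda>_. \<one>"]) auto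
  then show ?case unfolding positive_def by blast
next
  case (Suc n)
  obtain \<psi> where \<psi>: "\<psi> \<in> fmls 1 (params \<phi> \<union> g ` (fv \<phi> - {n}))"
    "\<forall>x. sat G (\<lambda>_. x) \<psi> \<longleftrightarrow> sat G (g(n := x)) \<phi>"
    using close_formula[of \<phi> g n G] by blast
  have "fv \<phi> - {n} \<subseteq> {..<n}" "params \<phi> = {}"
    using Suc.prems(1) by (auto simp: fmls_def subset_iff less_Suc_eq)
  then have "params \<phi> \<union> g ` (fv \<phi> - {n}) \<subseteq> g ` {..<n}" by (simp add: image_mono)
  then have "\<psi> \<in> fmls 1 (g ` {..<n})" using \<psi>(1) fmls_mono by blast
  moreover have "sat G (\<lambda>_. g n) \<psi>" using \<psi>(2) Suc.prems(2) by simp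
  ultimately have "generic_set G (dset \<psi>)" using g unfolding generic_sequence_def by blast
  then obtain N where N: "covers G N (dset \<psi>)" using generic_set_iff_covers dset_subset by blast
  then have "0 < N" using one_closed unfolding covers_def by (cases N) auto
  obtain \<theta> where \<theta>: "\<theta> \<in> fmls n {}"
    "\<forall>e. sat G e \<theta> \<longleftrightarrow> covers G N {x \<in> carrier G. sat G (e(n := x)) \<phi>}"
    using covering_formula[OF Suc.prems(1), of N] by blast
  have "sat G g \<theta>" using \<theta>(2) N \<psi>(2) by (simp add: dset_def)
  then have pos: "positive \<theta>" using Suc.IH \<theta>(1) by blast
  show ?case unfolding positive_def
  proof
    fix k
    obtain M :: nat where M: "\<forall>c. (\<forall>i j. c i j \<in> carrier G) \<longrightarrow>
        (\<exists>K u. K \<subseteq> {..<M} \<and> card K = 2 * N * k \<and> (\<forall>j. u j \<in> carrier G) \<and>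
          (\<forall>i\<in>K. sat G (\<lambda>j. c i j \<otimes> u j) \<theta>))"
      using pos[unfolded positive_def, rule_format, of "2 * N * k"] by blast
    have "\<exists>K u. K \<subseteq> {..<M} \<and> card K = k \<and> (\<forall>j. u j \<in> carrier G) \<and>
        (\<forall>i\<in>K. sat G (\<lambda>j. c i j \<otimes> u j) \<phi>)"
      if c: "\<forall>i j. c i j \<in> carrier G" for c
    proof -
      obtain K u where K: "K \<subseteq> {..<M}" "card K = 2 * N * k" "\<forall>j. u j \<in> carrier G"
        "\<forall>i\<in>K. sat G (\<lambda>j. c i j \<otimes> u j) \<theta>"
        using M[rule_format, of c] c by blast
      \<comment> \<open>The fibre of \<open>\<phi>\<close> over the \<open>i\<close>-th translate of
        \<open>u\<close>, shifted back by \<open>c i n\<close> in the last coordinate; the shift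
        keeps the covering number.\<close>
      define Y where
        "Y i = {v \<in> carrier G. sat G ((\<lambda>j. c i j \<otimes> u j)(n := c i n \<otimes> v)) \<phi>}" for i
      have "covers G N (Y i)" if i: "i \<in> K" for i
      proof -
        obtain z where z: "\<forall>j. z j \<in> carrier G"
          "\<forall>x\<in>carrier G. \<exists>j<N. z j \<otimes> x \<in>
             {x \<in> carrier G. sat G ((\<lambda>j. c i j \<otimes> u j)(n := x)) \<phi>}"
          using K(4) i \<theta>(2) unfolding covers_def by blast
        have "c i n \<otimes> (inv (c i n) \<otimes> z j \<otimes> x) = z j \<otimes> x" if "x \<in> carrier G" for j x
        proof -
          have "c i n \<in> carrier G" "z j \<in> carrier G" using c z(1) by auto
          then show ?thesis using that by (simp add: m_assoc[symmetric])
        qed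
        then have "\<forall>x\<in>carrier G. \<exists>j<N. inv (c i n) \<otimes> z j \<otimes> x \<in> Y i"
          using z c unfolding Y_def by simp
        moreover have "\<forall>j. inv (c i n) \<otimes> z j \<in> carrier G" using c z(1) by simp
        ultimately show ?thesis unfolding covers_def
          by (intro exI[of _ "\<lambda>j. inv (c i n) \<otimes> z j"]) blast
      qed
      moreover have "finite K" using K(1) finite_subset by blast
      ultimately obtain v where v: "v \<in> carrier G" "k \<le> card {i \<in> K. v \<in> Y i}"
        using covers_common_point[of K N Y k] K(2) \<open>0 < N\<close> by auto
      obtain K' where K': "K' \<subseteq> {i \<in> K. v \<in> Y i}" "card K' = k"
        using obtain_subset_with_card_n[OF v(2)] by blast
      have upd: "(\<lambda>j. c i j \<otimes> u j)(n := c i n \<otimes> v) = (\<lambda>j. c i j \<otimes> (u(n := v)) j)" for i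
        by (auto simp: fun_eq_iff)
      have "sat G (\<lambda>j. c i j \<otimes> (u(n := v)) j) \<phi>" if "i \<in> K'" for i
      proof -
        have "v \<in> Y i" using K'(1) that by blast
        then show ?thesis unfolding Y_def mem_Collect_eq upd by (rule conjunct2)
      qed
      moreover have "\<forall>j. (u(n := v)) j \<in> carrier G" using K(3) v(1) by simp
      moreover have "K' \<subseteq> {..<M}" using K'(1) K(1) by blast
      ultimately show ?thesis using K'(2)
        by (intro exI[of _ K'] exI[of _ "u(n := v)"] conjI ballI)
    qed
    then show "\<exists>M::nat. \<forall>c. (\<forall>i j. c i j \<in> carrier G) \<longrightarrow>
        (\<exists>K u. K \<subseteq> {..<M} \<and> card K = k \<and> (\<forall>j. u j \<in> carrier G) \<and>
          (\<forall>i\<in>K. sat G (\<lambda>j. c i j \<otimes> u j) \<phi>))" by blast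
  qed
qed

end

section \<open>Saturation and the existence of generic sequences\<close>

locale monster_comm_group = stable_comm_group G for G :: "('a, 'r) rel_group" (structure) +
  fixes \<kappa> :: "'k rel"
  assumes monster: "monster G \<kappa>"
begin

lemma small_finite:
  assumes "finite A" "A \<subseteq> carrier G"
  shows "small G \<kappa> A"
proof -
  have "|A| <o natLeq" using assms(1) finite_iff_ordLess_natLeq by blast
  moreover have "natLeq <o \<kappa>" using monster by (simp add: monster_def)
  ultimately show ?thesis using assms(2) ordLess_transitive unfolding small_def by blast
qed

lemma realize_ultrafilter:
  assumes P: "generic_ultrafilter P" and A: "finite A" "A \<subseteq> carrier G"
  shows "\<exists>g\<in>carrier G. tp G [g] A = {\<phi> \<in> fmls 1 A. dset \<phi> \<in> P}"
proof -
  define p where "p = {\<phi> \<in> fmls 1 A. dset \<phi> \<in> P}"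
  have "\<exists>xs\<in>tuples G 1. \<forall>\<phi>\<in>F. holds G xs \<phi>" if F: "finite F" "F \<subseteq> p" for F
  proof -
    have "finite (dset ` F)" "dset ` F \<subseteq> P" using F by (auto simp: p_def)
    then have "generic_set G (carrier G \<inter> \<Inter>(dset ` F))"
      using P unfolding generic_ultrafilter_def by blast
    then have "carrier G \<inter> \<Inter>(dset ` F) \<noteq> {}" using not_generic_set_empty by (intro notI) simp
    then obtain x where x: "x \<in> carrier G" "\<forall>\<phi>\<in>F. x \<in> dset \<phi>" by blast
    have "holds G [x] \<phi>" if "\<phi> \<in> F" for \<phi>
    proof -
      have "\<phi> \<in> fmls 1 A" using F(2) that by (auto simp: p_def)
      from holds_singleton[OF this, of G] show ?thesis using x(2) that by (simp add: dset_def)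
    qed
    moreover have "[x] \<in> tuples G 1" using x(1) by (simp add: tuples_def)
    ultimately show ?thesis by (intro bexI[of _ "[x]"] ballI)
  qed
  moreover have "\<phi> \<in> p \<or> Neg \<phi> \<in> p" if "\<phi> \<in> fmls 1 A" for \<phi>
  proof -
    have "dset \<phi> \<in> P \<or> carrier G - dset \<phi> \<in> P"
      using P definable_dset[OF that A(2)] unfolding generic_ultrafilter_def by blast
    then show ?thesis using that by (simp add: p_def dset_Neg)
  qed
  ultimately have "p \<in> complete_types G 1 A"
    unfolding complete_types_def by (auto simp: p_def)
  then obtain xs where xs: "xs \<in> tuples G 1" "tp G xs A = p"
    using monster small_finite[OF A] unfolding monster_def saturated_def by blast
  then obtain g where "xs = [g]" "g \<in> carrier G"
    by (auto simp: tuples_def length_Suc_conv)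
  then show ?thesis using xs(2) unfolding p_def by blast
qed

text \<open>Each term realizes the restriction of one ultrafilter to the earlier terms, a finite and
  hence small set. Therefore all terms have the same type over the empty set.\<close>

lemma ex_generic_sequence: "\<exists>g. generic_sequence g"
proof -
  obtain P where P: "generic_ultrafilter P" using ex_generic_ultrafilter by blast
  have "\<exists>g. \<forall>n::nat. g n \<in> carrier G \<and>
      tp G [g n] (g ` {..<n}) = {\<phi> \<in> fmls 1 (g ` {..<n}). dset \<phi> \<in> P}"
  proof (rule dependent_wellorder_choice)
    fix r and f h :: "nat \<Rightarrow> 'a" and n
    assume "\<And>y. y < n \<Longrightarrow> f y = h y"
    then have "f ` {..<n} = h ` {..<n}" by auto
    then show "(r \<in> carrier G \<and>
          tp G [r] (f ` {..<n}) = {\<phi> \<in> fmls 1 (f ` {..<n}). dset \<phi> \<in> P}) =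
        (r \<in> carrier G \<and>
          tp G [r] (h ` {..<n}) = {\<phi> \<in> fmls 1 (h ` {..<n}). dset \<phi> \<in> P})" by simp
  next
    fix n and f :: "nat \<Rightarrow> 'a"
    assume "\<And>y. y < n \<Longrightarrow> f y \<in> carrier G \<and>
      tp G [f y] (f ` {..<y}) = {\<phi> \<in> fmls 1 (f ` {..<y}). dset \<phi> \<in> P}"
    then have "f ` {..<n} \<subseteq> carrier G" by blast
    then show "\<exists>r. r \<in> carrier G \<and>
        tp G [r] (f ` {..<n}) = {\<phi> \<in> fmls 1 (f ` {..<n}). dset \<phi> \<in> P}"
      using realize_ultrafilter[OF P, of "f ` {..<n}"] by blast
  qed
  then obtain g :: "nat \<Rightarrow> 'a" where g_all: "\<forall>n. g n \<in> carrier G \<and>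
      tp G [g n] (g ` {..<n}) = {\<phi> \<in> fmls 1 (g ` {..<n}). dset \<phi> \<in> P}" by (rule exE)
  then have g: "g n \<in> carrier G"
    "tp G [g n] (g ` {..<n}) = {\<phi> \<in> fmls 1 (g ` {..<n}). dset \<phi> \<in> P}" for n
    by simp_all
  have mem: "sat G (\<lambda>_. g n) \<phi> \<longleftrightarrow> dset \<phi> \<in> P" if "\<phi> \<in> fmls 1 (g ` {..<n})" for n \<phi>
  proof -
    have "sat G (\<lambda>_. g n) \<phi> \<longleftrightarrow> \<phi> \<in> tp G [g n] (g ` {..<n})"
      using that holds_singleton[OF that, of G] by (simp add: tp_def)
    then show ?thesis using that g(2)[of n] by simp
  qed
  have "tp G [g n] {} = {\<phi> \<in> fmls 1 {}. dset \<phi> \<in> P}" for n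
  proof -
    have "holds G [g n] \<phi> \<longleftrightarrow> dset \<phi> \<in> P" if "\<phi> \<in> fmls 1 {}" for \<phi>
      using mem[of \<phi> n] holds_singleton[OF that, of G] that fmls_mono[of "{}" "g ` {..<n}" 1]
      by blast
    then show ?thesis by (auto simp: tp_def)
  qed
  moreover have "generic_set G (dset \<phi>)"
    if "\<phi> \<in> fmls 1 (g ` {..<n})" "sat G (\<lambda>_. g n) \<phi>" for n \<phi>
  proof -
    have "dset \<phi> \<in> P" using that mem by blast
    then have "generic_set G (carrier G \<inter> \<Inter>{dset \<phi>})"
      using P unfolding generic_ultrafilter_def by blast
    moreover have "carrier G \<inter> \<Inter>{dset \<phi>} = dset \<phi>" using dset_subset by auto
    ultimately show ?thesis by simp
  qed
  ultimately have "generic_sequence g" unfolding generic_sequence_def using g(1) by simp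
  then show ?thesis by blast
qed

end

section \<open>Powers\<close>

lemma bezout_cofactors:
  fixes q :: "'i \<Rightarrow> int"
  assumes "finite I" "I \<noteq> {}"
    and "\<And>i j. i \<in> I \<Longrightarrow> j \<in> I \<Longrightarrow> i \<noteq> j \<Longrightarrow> coprime (q i) (q j)"
  shows "\<exists>u. (\<Sum>i\<in>I. u i * (\<Prod>j\<in>I - {i}. q j)) = 1"
  using assms
proof (induction I rule: finite_ne_induct)
  case (singleton i)
  show ?case by (intro exI[of _ "\<lambda>_. 1"]) simp
next
  case (insert i I)
  then obtain u where u: "(\<Sum>l\<in>I. u l * (\<Prod>j\<in>I - {l}. q j)) = 1" by auto
  have "coprime (q i) (prod q I)"
    using insert.prems insert.hyps(3) by (intro prod_coprime_right) auto
  then obtain a b where ab: "a * q i + b * prod q I = 1"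
    using bezout_int[of "q i" "prod q I"] by (metis coprime_imp_gcd_eq_1)
  \<comment> \<open>Each old cofactor gains the factor \<open>q i\<close>, so the old coefficients
    times \<open>a\<close> contribute \<open>a * q i\<close>; the new cofactor is
    \<open>prod q I\<close>, with coefficient \<open>b\<close>.\<close>
  define v where "v = (\<lambda>l. if l = i then b else a * u l)"
  have "(\<Prod>j\<in>insert i I - {l}. q j) = q i * (\<Prod>j\<in>I - {l}. q j)" if "l \<in> I" for l
  proof -
    have "insert i I - {l} = insert i (I - {l})" using that insert.hyps(3) by auto
    then show ?thesis using insert.hyps(1,3) by simp
  qed
  then have "(\<Sum>l\<in>I. v l * (\<Prod>j\<in>insert i I - {l}. q j))
      = (\<Sum>l\<in>I. a * q i * (u l * (\<Prod>j\<in>I - {l}. q j)))"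
    using insert.hyps(3) by (intro sum.cong) (auto simp: v_def)
  also have "\<dots> = a * q i" using u by (simp add: sum_distrib_left[symmetric])
  finally have "(\<Sum>l\<in>insert i I. v l * (\<Prod>j\<in>insert i I - {l}. q j)) = 1"
    using insert.hyps(1,3) ab by (simp add: v_def)
  then show ?case by blast
qed

text \<open>The language has no symbol for the identity, so only positive powers are terms.\<close>

primrec pow_trm :: "'a trm \<Rightarrow> nat \<Rightarrow> 'a trm" where
  "pow_trm t 0 = t"
| "pow_trm t (Suc n) = Mult (pow_trm t n) t"

lemma fv_pow_trm [simp]: "fv_trm (pow_trm t n) = fv_trm t"
  by (induction n) auto

lemma params_pow_trm [simp]: "params_trm (pow_trm t n) = params_trm t"
  by (induction n) auto

section \<open>Coprime exponents and monomials in generics\<close>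

context comm_group
begin

text \<open>A relation \<open>a * m + b * q = 1\<close> gives \<open>x\<close> as the product of the
  \<open>a\<close>-th power of \<open>x [^] m\<close> and the \<open>q\<close>-th power of
  \<open>x [^] b\<close>; both factors are \<open>q\<close>-th powers.\<close>

lemma coprime_power_root:
  assumes x: "x \<in> carrier G" and z: "z \<in> carrier G" and eq: "x [^] (m::nat) = z [^] (q::nat)"
    and "coprime m q"
  shows "\<exists>y\<in>carrier G. x = y [^] q"
proof -
  obtain a b where ab: "a * int m + b * int q = 1"
    using bezout_int[of "int m" "int q"] \<open>coprime m q\<close> by (metis coprime_imp_gcd_eq_1 coprime_int_iff)
  have "x = x [^] (a * int m + b * int q)" using ab x by simp
  also have "\<dots> = x [^] (int m * a) \<otimes> x [^] (b * int q)"
    using x by (simp add: int_pow_mult mult.commute)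
  also have "x [^] (int m * a) = (z [^] a) [^] int q"
  proof -
    have "x [^] (int m * a) = (x [^] m) [^] a" using x by (simp add: int_pow_pow[symmetric] int_pow_int)
    also have "\<dots> = z [^] (int q * a)" using z eq by (simp add: int_pow_pow[symmetric] int_pow_int)
    also have "\<dots> = (z [^] a) [^] int q" using z by (simp add: int_pow_pow mult.commute)
    finally show ?thesis .
  qed
  also have "x [^] (b * int q) = (x [^] b) [^] int q" using x by (simp add: int_pow_pow)
  also have "(z [^] a) [^] int q \<otimes> (x [^] b) [^] int q = (z [^] a \<otimes> x [^] b) [^] q"
    using x z by (simp add: nat_pow_distrib int_pow_int)
  finally show ?thesis using x z by (intro bexI[of _ "z [^] a \<otimes> x [^] b"]) auto
qed

lemma finprod_int_pow:
  assumes "x \<in> carrier G" "finite I"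
  shows "finprod G (\<lambda>i. x [^] (f i :: int)) I = x [^] (\<Sum>i\<in>I. f i)"
  using assms(2)
proof (induction I rule: finite_induct)
  case (insert i I)
  then have "finprod G (\<lambda>i. x [^] f i) (insert i I) = x [^] f i \<otimes> x [^] (\<Sum>i\<in>I. f i)"
    using assms(1) by (subst finprod_insert) auto
  then show ?case using insert.hyps assms(1) by (simp add: int_pow_mult)
qed simp

lemma finprod_nat_pow:
  assumes "finite I" "f \<in> I \<rightarrow> carrier G"
  shows "finprod G (\<lambda>i. f i [^] (q::nat)) I = finprod G f I [^] q"
  using assms
proof (induction I rule: finite_induct)
  case (insert i I)
  then have "f i \<in> carrier G" "f \<in> I \<rightarrow> carrier G" by auto
  moreover have "finprod G (\<lambda>i. f i [^] q) (insert i I) = f i [^] q \<otimes> finprod G (\<lambda>i. f i [^] q) I"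
    using insert.hyps calculation by (subst finprod_insert) auto
  ultimately show ?case using insert by (simp add: nat_pow_distrib)
qed simp

end

context stable_comm_group
begin

lemma mem_power_subgroup_iff: "x \<in> power_subgroup G q \<longleftrightarrow> (\<exists>y\<in>carrier G. x = y [^] q)"
  by (auto simp: power_subgroup_def)

lemma subgroup_power_subgroup: "subgroup (power_subgroup G q) G"
proof (rule subgroupI)
  show "power_subgroup G q \<subseteq> carrier G" by (auto simp: power_subgroup_def)
  show "power_subgroup G q \<noteq> {}" by (auto simp: power_subgroup_def)
next
  fix a assume "a \<in> power_subgroup G q"
  then obtain x where x: "x \<in> carrier G" "a = x [^] q" unfolding mem_power_subgroup_iff by blast
  then have "inv a = (inv x) [^] q" by (simp add: nat_pow_inv)
  then show "inv a \<in> power_subgroup G q"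
    unfolding mem_power_subgroup_iff using x(1) by (intro bexI[of _ "inv x"]) auto
next
  fix a b assume "a \<in> power_subgroup G q" "b \<in> power_subgroup G q"
  then obtain x y where xy: "x \<in> carrier G" "a = x [^] q" "y \<in> carrier G" "b = y [^] q"
    unfolding mem_power_subgroup_iff by blast
  then have "a \<otimes> b = (x \<otimes> y) [^] q" by (simp add: nat_pow_distrib)
  then show "a \<otimes> b \<in> power_subgroup G q"
    unfolding mem_power_subgroup_iff using xy(1,3) by (intro bexI[of _ "x \<otimes> y"]) auto
qed

text \<open>The index of \<open>pow_trm\<close> is one less than the exponent, hence the arguments
  \<open>q - 1\<close> and \<open>Q n - 1\<close> below, for positive exponents.\<close>

lemma eval_pow_trm:
  "eval_trm G e t \<in> carrier G \<Longrightarrow> eval_trm G e (pow_trm t n) = eval_trm G e t [^] Suc n"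
  by (induction n) auto

lemma ex_monomial_trm:
  assumes "0 < n" "\<And>i. 0 < Q i"
  shows "\<exists>t. fv_trm t \<subseteq> {..<n} \<and> params_trm t = {} \<and>
    (\<forall>e. (\<forall>i. e i \<in> carrier G) \<longrightarrow> eval_trm G e t = finprod G (\<lambda>i. e i [^] (Q i :: nat)) {..<n})"
  using assms(1)
proof (induction n rule: nat_induct_non_zero)
  case 1
  have "eval_trm G e (pow_trm (Var 0) (Q 0 - 1)) = finprod G (\<lambda>i. e i [^] Q i) {..<1}"
    if "\<forall>i. e i \<in> carrier G" for e
  proof -
    have "eval_trm G e (pow_trm (Var 0) (Q 0 - 1)) = e 0 [^] Q 0"
      using eval_pow_trm[of e "Var 0" "Q 0 - 1"] that assms(2)[of 0] by simp
    then show ?thesis using that by (simp add: lessThan_Suc)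
  qed
  then show ?case by (intro exI[of _ "pow_trm (Var 0) (Q 0 - 1)"]) simp
next
  case (Suc n)
  then obtain t where t: "fv_trm t \<subseteq> {..<n}" "params_trm t = {}"
    "\<forall>e. (\<forall>i. e i \<in> carrier G) \<longrightarrow> eval_trm G e t = finprod G (\<lambda>i. e i [^] Q i) {..<n}" by blast
  have "eval_trm G e (Mult (pow_trm (Var n) (Q n - 1)) t) = finprod G (\<lambda>i. e i [^] Q i) {..<Suc n}"
    if "\<forall>i. e i \<in> carrier G" for e
  proof -
    have "eval_trm G e (pow_trm (Var n) (Q n - 1)) = e n [^] Q n"
      using eval_pow_trm[of e "Var n" "Q n - 1"] that assms(2)[of n] by simp
    then show ?thesis using that t(3) by (simp add: lessThan_Suc)
  qed
  moreover have "fv_trm (Mult (pow_trm (Var n) (Q n - 1)) t) \<subseteq> {..<Suc n}" using t(1) by auto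
  ultimately show ?case using t(2)
    by (intro exI[of _ "Mult (pow_trm (Var n) (Q n - 1)) t"]) simp
qed

text \<open>The formula \<open>\<phi>'\<close>, saying that the monomial in \<open>n\<close>
  variables satisfies \<open>\<phi>\<close>, holds of \<open>g\<close> and is therefore positive. If
  \<open>\<phi>\<close> were not generic, it would have \<open>k\<close>-inconsistent translates by
  some \<open>c i\<close>; lifted to tuples, these would contradict positivity.\<close>

lemma monomial_generic:
  assumes g: "generic_sequence g" and n: "0 < n" and Q: "\<And>i. 0 < Q i"
    and bez: "(\<Sum>i<n. u i * int (Q i)) = 1"
    and \<phi>: "\<phi> \<in> fmls 1 {}" "sat G (\<lambda>_. finprod G (\<lambda>i. g i [^] Q i) {..<n}) \<phi>"
  shows "generic_set G (dset \<phi>)"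
proof (rule ccontr)
  assume "\<not> generic_set G (dset \<phi>)"
  then obtain c :: "nat \<Rightarrow> 'a" and k where c: "\<forall>n. c n \<in> carrier G"
    "\<forall>K x. finite K \<and> card K = k \<and> x \<in> carrier G \<longrightarrow> (\<exists>n\<in>K. c n \<otimes> x \<notin> dset \<phi>)"
    using nongeneric_translates[OF definable_dset[OF \<phi>(1)]] by blast
  obtain t where t: "fv_trm t \<subseteq> {..<n}" "params_trm t = {}"
    "\<forall>e. (\<forall>i. e i \<in> carrier G) \<longrightarrow> eval_trm G e t = finprod G (\<lambda>i. e i [^] Q i) {..<n}"
    using ex_monomial_trm[of n Q, OF n Q] by (elim exE conjE)
  define \<sigma> where "\<sigma> i = (if i = 0 then t else Var (n + i))" for i :: nat
  define \<phi>' where "\<phi>' = subst n \<sigma> Const \<phi>"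
  have \<phi>': "sat G e \<phi>' \<longleftrightarrow> sat G (\<lambda>_. finprod G (\<lambda>i. e i [^] Q i) {..<n}) \<phi>"
    if "\<forall>i. e i \<in> carrier G" for e
  proof -
    have "sat G e \<phi>' \<longleftrightarrow> sat G (\<lambda>i. eval_trm G e (\<sigma> i)) \<phi>"
      unfolding \<phi>'_def using t(1) by (intro sat_subst) (auto simp: \<sigma>_def)
    also have "\<dots> \<longleftrightarrow> sat G (\<lambda>_. finprod G (\<lambda>i. e i [^] Q i) {..<n}) \<phi>"
      using \<phi>(1) t(3) that by (intro sat_cong) (auto simp: \<sigma>_def fmls_def)
    finally show ?thesis .
  qed
  have gc: "\<forall>i. g i \<in> carrier G" using g by (simp add: generic_sequence_def)
  have "\<phi>' \<in> fmls n {}"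
    unfolding \<phi>'_def using \<phi>(1) t(1,2) by (intro subst_in_fmls) (auto simp: \<sigma>_def fmls_def)
  moreover have "sat G g \<phi>'" using \<phi>'[OF gc] \<phi>(2) by simp
  ultimately have pos: "positive \<phi>'" using generic_sequence_positive[OF g] by blast
  \<comment> \<open>By the Bezout relation the monomial sends the tuple \<open>h i\<close> to
    \<open>c i\<close>, so translating a tuple by \<open>h i\<close> translates its monomial by
    \<open>c i\<close>.\<close>
  define h where "h i j = c i [^] u j" for i j
  have h: "h i j \<in> carrier G" for i j using c(1) by (simp add: h_def)
  have prod_h: "finprod G (\<lambda>j. h i j [^] Q j) {..<n} = c i" for i
  proof -
    have "finprod G (\<lambda>j. h i j [^] Q j) {..<n} = finprod G (\<lambda>j. c i [^] (u j * int (Q j))) {..<n}"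
      using c(1) by (intro finprod_cong') (auto simp: h_def int_pow_pow[symmetric] int_pow_int)
    also have "\<dots> = c i" using c(1) bez by (simp add: finprod_int_pow)
    finally show ?thesis .
  qed
  obtain M :: nat where M: "\<forall>c. (\<forall>i j. c i j \<in> carrier G) \<longrightarrow>
      (\<exists>K u. K \<subseteq> {..<M} \<and> card K = k \<and> (\<forall>j. u j \<in> carrier G) \<and>
        (\<forall>i\<in>K. sat G (\<lambda>j. c i j \<otimes> u j) \<phi>'))"
    using pos[unfolded positive_def, rule_format, of k] by blast
  have "\<forall>i j. h i j \<in> carrier G" using h by simp
  from mp[OF spec[OF M, of h] this] obtain K v where K: "K \<subseteq> {..<M}" "card K = k" "\<forall>j. v j \<in> carrier G"
    "\<forall>i\<in>K. sat G (\<lambda>j. h i j \<otimes> v j) \<phi>'"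
    by (elim exE conjE)
  define x where "x = finprod G (\<lambda>j. v j [^] Q j) {..<n}"
  have x: "x \<in> carrier G" unfolding x_def using K(3) by (intro finprod_closed) auto
  have "c i \<otimes> x \<in> dset \<phi>" if "i \<in> K" for i
  proof -
    have "finprod G (\<lambda>j. (h i j \<otimes> v j) [^] Q j) {..<n} =
        finprod G (\<lambda>j. h i j [^] Q j \<otimes> v j [^] Q j) {..<n}"
      using h K(3) by (intro finprod_cong') (auto simp: nat_pow_distrib)
    also have "\<dots> = c i \<otimes> x"
      using h K(3) prod_h[of i] by (simp add: finprod_multf x_def Pi_def)
    finally have "finprod G (\<lambda>j. (h i j \<otimes> v j) [^] Q j) {..<n} = c i \<otimes> x" .
    moreover have "\<forall>j. h i j \<otimes> v j \<in> carrier G" using h K(3) by simp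
    moreover have "sat G (\<lambda>j. h i j \<otimes> v j) \<phi>'" using K(4) that by blast
    ultimately have "sat G (\<lambda>_. c i \<otimes> x) \<phi>" using \<phi>'[of "\<lambda>j. h i j \<otimes> v j"] by simp
    then show ?thesis using c(1) x by (simp add: dset_def)
  qed
  moreover have "finite K" using K(1) finite_subset by blast
  ultimately show False using c(2) K(2) x by blast
qed

end

section \<open>Weight\<close>

context stable_comm_group
begin

lemma not_generic_coset:
  assumes H: "subgroup H G" "infinite (rcosets H)" and h: "h \<in> carrier G"
  shows "\<not> generic_set G (h <# H)"
proof
  assume "generic_set G (h <# H)"
  then obtain F where F: "finite F" "F \<subseteq> carrier G" "carrier G = (\<Union>g\<in>F. g <# (h <# H))"
    unfolding generic_set_def by blast
  have "R \<in> (\<lambda>f. H #> (f \<otimes> h)) ` F" if "R \<in> rcosets H" for R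
  proof -
    obtain x where x: "x \<in> carrier G" "R = H #> x" using \<open>R \<in> rcosets H\<close> unfolding RCOSETS_def by blast
    have "x \<in> (\<Union>g\<in>F. g <# (h <# H))" using x(1) F(3) by (rule subst[rotated])
    then obtain f y where f: "f \<in> F" "y \<in> H" "x = f \<otimes> (h \<otimes> y)" unfolding l_coset_def by blast
    have "f \<in> carrier G" "y \<in> carrier G" using f F(2) subgroup.mem_carrier[OF H(1)] by auto
    then have "x = y \<otimes> (f \<otimes> h)" using f(3) h by (simp add: m_ac)
    then have "x \<in> H #> (f \<otimes> h)" using f(2) unfolding r_coset_def by blast
    then have "R = H #> (f \<otimes> h)"
      using repr_independence[of x H "f \<otimes> h"] x(2) H(1) h \<open>f \<in> carrier G\<close> by simp
    then show ?thesis using f(1) by blast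
  qed
  then have "rcosets H \<subseteq> (\<lambda>f. H #> (f \<otimes> h)) ` F" by blast
  then show False using H(2) F(1) finite_subset by blast
qed

text \<open>The coset of \<open>g s\<close> is definable over \<open>g s\<close> and, the index
  being infinite, not generic; a term generic over \<open>g s\<close> avoids it.\<close>

lemma generic_sequence_cosets:
  assumes g: "generic_sequence g" and q: "0 < q" "infinite (rcosets (power_subgroup G q))"
    and "s < t" "y \<in> carrier G"
  shows "g t \<noteq> g s \<otimes> y [^] q"
proof
  assume eq: "g t = g s \<otimes> y [^] q"
  define \<chi> :: "('a, 'r) fm" where
    "\<chi> = Ex 1 (Eq (Var 0) (Mult (Const (g s)) (pow_trm (Var 1) (q - 1))))"
  have sat: "sat G (\<lambda>_. x) \<chi> \<longleftrightarrow> (\<exists>y\<in>carrier G. x = g s \<otimes> y [^] q)" for x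
    using q(1) by (simp add: \<chi>_def eval_pow_trm del: nat_pow_Suc)
  have gs: "g s \<in> carrier G" using g by (simp add: generic_sequence_def)
  have "\<chi> \<in> fmls 1 (g ` {..<t})" using \<open>s < t\<close> by (auto simp: \<chi>_def fmls_def)
  moreover have "sat G (\<lambda>_. g t) \<chi>" using sat eq \<open>y \<in> carrier G\<close> by blast
  ultimately have "generic_set G (dset \<chi>)" using g unfolding generic_sequence_def by blast
  moreover have "dset \<chi> = g s <# power_subgroup G q"
    using gs unfolding dset_def sat l_coset_def power_subgroup_def by auto
  ultimately show False using not_generic_coset[OF subgroup_power_subgroup q(2) gs] by simp
qed

text \<open>The cosets of the \<open>g n [^] m\<close> modulo \<open>q\<close>-th powers are
  pairwise disjoint: a common point of two would make the \<open>m\<close>-th power of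
  \<open>inv (g s) \<otimes> g t\<close> a \<open>q\<close>-th power, hence also
  \<open>inv (g s) \<otimes> g t\<close> itself, as \<open>m\<close> and \<open>q\<close> are
  coprime. So the coset formula divides with \<open>k = 2\<close>.\<close>

lemma coset_forks:
  assumes g: "generic_sequence g" and q: "0 < q" "infinite (rcosets (power_subgroup G q))"
    and m: "0 < m" "coprime m q" and y: "y \<in> carrier G"
  shows "forks G {} 1 (tp G [g i [^] m \<otimes> y [^] q] {g i})"
proof -
  have gc: "g n \<in> carrier G" for n using g by (simp add: generic_sequence_def)
  \<comment> \<open>\<open>\<phi>\<close> is \<open>\<psi>\<close> with the parameter as a constant:
    types contain parameters as constants, while \<open>divides\<close> takes them for
    variables.\<close>
  define \<phi> :: "('a, 'r) fm" where "\<phi> =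
    Ex 2 (Eq (Var 0) (Mult (pow_trm (Const (g i)) (m - 1)) (pow_trm (Var 2) (q - 1))))"
  define \<psi> :: "('a, 'r) fm" where "\<psi> =
    Ex 2 (Eq (Var 0) (Mult (pow_trm (Var 1) (m - 1)) (pow_trm (Var 2) (q - 1))))"
  have \<phi>: "holds G [x] \<phi> \<longleftrightarrow> (\<exists>z\<in>carrier G. x = g i [^] m \<otimes> z [^] q)" for x
    using q(1) m(1) gc by (simp add: \<phi>_def eval_pow_trm del: nat_pow_Suc)
  have \<psi>: "holds G ([x] @ [b]) \<psi> \<longleftrightarrow> (\<exists>z\<in>carrier G. x = b [^] m \<otimes> z [^] q)"
    if "b \<in> carrier G" for x b
    using q(1) m(1) that by (simp add: \<psi>_def eval_pow_trm del: nat_pow_Suc)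
  have neq: False
    if st: "s < t" and a: "a \<in> carrier G" and b: "b \<in> carrier G" and eq: "g s [^] m \<otimes> a [^] q = g t [^] m \<otimes> b [^] q"
    for s t a b
  proof -
    define x where "x = inv (g s) \<otimes> g t"
    have x: "x \<in> carrier G" using gc by (simp add: x_def)
    have "g t [^] m = g s [^] m \<otimes> a [^] q \<otimes> inv (b [^] q)"
      using a b eq gc by (simp add: m_assoc)
    then have "x [^] m = a [^] q \<otimes> inv (b [^] q)"
      unfolding x_def using a b gc
      by (simp add: nat_pow_distrib nat_pow_inv m_assoc[symmetric])
    also have "\<dots> = (a \<otimes> inv b) [^] q"
      using a b by (simp add: nat_pow_distrib nat_pow_inv)
    finally obtain z where z: "z \<in> carrier G" "x = z [^] q"
      using coprime_power_root[OF x _ _ m(2), of "a \<otimes> inv b"] a b by auto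
    have "g t = g s \<otimes> x" using gc by (simp add: x_def m_assoc[symmetric])
    then show False using generic_sequence_cosets[OF g q st z(1)] z(2) by simp
  qed
  have "divides G {} 1 \<psi> [g i]"
    unfolding divides_def
  proof (intro exI[of _ 2] exI[of _ "\<lambda>n. [g n]"] conjI allI impI notI)
    fix n
    show "[g n] \<in> tuples G (length [g i])" using gc by (simp add: tuples_def)
    show "tp G [g n] {} = tp G [g i] {}" using g unfolding generic_sequence_def by metis
  next
    fix K :: "nat set"
    assume K: "finite K \<and> card K = 2" and ex: "\<exists>xs\<in>tuples G 1. \<forall>i\<in>K. holds G (xs @ [g i]) \<psi>"
    obtain s t where st: "K = {s, t}" "s < t"
      using K by (auto simp: card_2_iff) (metis insert_commute linorder_neqE_nat)
    obtain xs where xs: "xs \<in> tuples G 1" "\<forall>i\<in>K. holds G (xs @ [g i]) \<psi>" using ex by blast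
    obtain x where x: "xs = [x]" using xs(1) by (auto simp: tuples_def length_Suc_conv)
    have "holds G ([x] @ [g s]) \<psi>" "holds G ([x] @ [g t]) \<psi>"
      using xs(2) unfolding x st(1) by blast+
    then obtain a b where ab: "a \<in> carrier G" "x = g s [^] m \<otimes> a [^] q"
      "b \<in> carrier G" "x = g t [^] m \<otimes> b [^] q"
      unfolding \<psi>[OF gc] by blast
    show False using neq[OF st(2) ab(1,3)] ab(2,4) by simp
  qed
  moreover have "\<psi> \<in> fmls (1 + length [g i]) {}" by (auto simp: \<psi>_def fmls_def)
  moreover have "\<phi> \<in> tp G [g i [^] m \<otimes> y [^] q] {g i}"
  proof -
    have "\<phi> \<in> fmls 1 {g i}" by (auto simp: \<phi>_def fmls_def)
    moreover have "holds G [g i [^] m \<otimes> y [^] q] \<phi>" unfolding \<phi> using y by blast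
    ultimately show ?thesis by (simp add: tp_def)
  qed
  moreover have "holds G (xs @ [g i]) \<psi>" if xs: "xs \<in> tuples G 1" "holds G xs \<phi>" for xs
  proof -
    obtain x where x: "xs = [x]" using xs(1) by (auto simp: tuples_def length_Suc_conv)
    show ?thesis using xs(2) unfolding x \<phi> \<psi>[OF gc] .
  qed
  ultimately show ?thesis
    unfolding forks_def using gc
    by (intro exI[of _ "{\<phi>}"] exI[of _ "{(\<psi>, [g i])}"]) simp
qed

end

lemma (in monster_comm_group) card_primes_le_weight:
  assumes weight: "group_has_weight G \<kappa> (enat w)"
    and S: "finite S" "\<And>q. q \<in> S \<Longrightarrow> prime q \<and> infinite (rcosets (power_subgroup G q))"
  shows "card S \<le> w"
proof (cases "S = {}")
  case False
  define n where "n = card S"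
  have n: "0 < n" using False S(1) by (simp add: n_def card_gt_0_iff)
  obtain q where q: "bij_betw q {..<n} S"
    using ex_bij_betw_nat_finite[OF S(1)] by (auto simp: n_def atLeast0LessThan)
  have inj: "inj_on q {..<n}" using q by (rule bij_betw_imp_inj_on)
  have prime: "prime (q i)" and index: "infinite (rcosets (power_subgroup G (q i)))" if "i < n" for i
    using S(2)[of "q i"] bij_betwE[OF q] that by auto
  have coprime: "coprime (q i) (q j)" if "i < n" "j < n" "i \<noteq> j" for i j
    using primes_coprime[OF prime prime] inj that by (auto simp: inj_on_def)
  define Q where "Q i = (\<Prod>j\<in>{..<n} - {i}. q j)" for i
  have Q: "0 < Q i" for i
    unfolding Q_def by (intro prod_pos ballI) (use prime prime_gt_0_nat in auto)
  have "\<exists>u. (\<Sum>i\<in>{..<n}. u i * (\<Prod>j\<in>{..<n} - {i}. int (q j))) = 1"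
    using n coprime by (intro bezout_cofactors) auto
  then obtain u where u: "(\<Sum>i<n. u i * int (Q i)) = 1" by (auto simp: Q_def)
  obtain g where g: "generic_sequence g" using ex_generic_sequence by blast
  have gc: "g i \<in> carrier G" for i using g by (simp add: generic_sequence_def)
  define a where "a = finprod G (\<lambda>i. g i [^] Q i) {..<n}"
  have a: "a \<in> carrier G" unfolding a_def using gc by (intro finprod_closed) auto
  have gen: "generic_set G (dset \<phi>)" if "\<phi> \<in> fmls 1 {}" "sat G (\<lambda>_. a) \<phi>" for \<phi>
    using monomial_generic[OF g n Q u that(1)] that(2) unfolding a_def by blast
  have "generic_type G {} (tp G [a] {})"
  proof -
    have "[a] \<in> tuples G 1" using a by (simp add: tuples_def)
    then have "tp G [a] {} \<in> complete_types G 1 {}"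
      unfolding complete_types_def by (auto simp: tp_def)
    moreover have "generic_set G {x \<in> carrier G. holds G [x] \<phi>}" if "\<phi> \<in> tp G [a] {}" for \<phi>
    proof -
      have \<phi>: "\<phi> \<in> fmls 1 {}" "holds G [a] \<phi>" using that by (auto simp: tp_def)
      then show ?thesis using gen[OF \<phi>(1)] unfolding holds_singleton[OF \<phi>(1)] dset_def by simp
    qed
    ultimately show ?thesis unfolding generic_type_def by blast
  qed
  moreover have small: "small G \<kappa> {}" by (rule small_finite) auto
  ultimately have w: "weight G \<kappa> {} (tp G [a] {}) = enat w"
    using weight unfolding group_has_weight_def by blast
  have dep: "\<not> indep G [a] {} (set [g i])" if i: "i < n" for i
  proof -
    \<comment> \<open>For \<open>j \<noteq> i\<close> the exponent \<open>Q j\<close> is divisible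
      by \<open>q i\<close>, so the factors of \<open>a\<close> other than the \<open>i\<close>-th
      form a \<open>q i\<close>-th power.\<close>
    define y where "y = finprod G (\<lambda>j. g j [^] (Q j div q i)) ({..<n} - {i})"
    have y: "y \<in> carrier G" unfolding y_def using gc by (intro finprod_closed) auto
    have "Q j div q i * q i = Q j" if "j \<in> {..<n} - {i}" for j
    proof -
      have "q i dvd Q j" unfolding Q_def using i that by (intro dvd_prodI) auto
      then show ?thesis by simp
    qed
    then have "finprod G (\<lambda>j. g j [^] Q j) ({..<n} - {i}) =
        finprod G (\<lambda>j. (g j [^] (Q j div q i)) [^] q i) ({..<n} - {i})"
      using gc by (intro finprod_cong') (auto simp: nat_pow_pow)
    also have "\<dots> = y [^] q i" unfolding y_def using gc by (intro finprod_nat_pow) auto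
    finally have rest: "finprod G (\<lambda>j. g j [^] Q j) ({..<n} - {i}) = y [^] q i" .
    have "a = finprod G (\<lambda>j. g j [^] Q j) (insert i ({..<n} - {i}))"
      unfolding a_def using i by (simp add: insert_absorb)
    also have "\<dots> = g i [^] Q i \<otimes> finprod G (\<lambda>j. g j [^] Q j) ({..<n} - {i})"
      using gc by (intro finprod_insert) auto
    finally have "a = g i [^] Q i \<otimes> y [^] q i" unfolding rest .
    moreover have "coprime (Q i) (q i)"
      unfolding Q_def using i coprime by (intro prod_coprime_left) auto
    ultimately have "forks G {} 1 (tp G [a] {g i})"
      using coset_forks[OF g prime_gt_0_nat[OF prime[OF i]] index[OF i] Q _ y] by simp
    then show ?thesis by (simp add: indep_def)
  qed
  \<comment> \<open>The witness for the weight has the empty set as \<open>B\<close>: the type of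
    \<open>a\<close> is its own non-forking extension, and the \<open>g i\<close> are independent
    over the empty set.\<close>
  have "\<not> forks G {} (length [a]) (tp G [a] {})"
    using generic_tp_not_forks[OF gen] by simp
  moreover have "indep_seq G {} (enat n) (\<lambda>i. [g i])"
  proof -
    have "(\<Union>j<i. set [g j]) = g ` {..<i}" for i by auto
    then have "indep G [g i] {} (\<Union>j<i. set [g j])" for i
      using generic_sequence_not_forks[OF g, of "g ` {..<i}" i "{}"] by (simp add: indep_def)
    then show ?thesis unfolding indep_seq_def using gc by simp
  qed
  ultimately have "enat n \<le> weight G \<kappa> {} (tp G [a] {})"
    unfolding weight_def using small a dep
    by (intro Sup_upper CollectI exI[of _ "{}"] exI[of _ "[a]"] exI[of _ "\<lambda>i. [g i]"]) auto
  then show ?thesis using w by (simp add: n_def)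
qed simp

theorem proposition3p1:
  fixes G :: "('a, 'r) rel_group" and \<kappa> :: "'k rel" and w :: nat
  assumes "comm_group G"
    and "relations_wf G"
    and "monster G \<kappa>"
    and "stable_theory G"
    and "group_has_weight G \<kappa> (enat w)"
  shows "finite {q. prime q \<and> infinite (rcosets\<^bsub>G\<^esub> (power_subgroup G q))} \<and>
         card {q. prime q \<and> infinite (rcosets\<^bsub>G\<^esub> (power_subgroup G q))} \<le> w"
proof -
  interpret comm_group G by (rule assms(1))
  interpret monster_comm_group G \<kappa> by unfold_locales (rule assms)+
  define S where "S = {q. prime q \<and> infinite (rcosets\<^bsub>G\<^esub> (power_subgroup G q))}"
  \<comment> \<open>The bound concerns finite sets of primes; an infinite \<open>S\<close> would
    have a subset of \<open>w + 1\<close> elements.\<close>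
  have card_le: "card T \<le> w" if "finite T" "T \<subseteq> S" for T
    using that by (intro card_primes_le_weight[OF assms(5)]) (auto simp: S_def)
  have "finite S"
  proof (rule ccontr)
    assume "infinite S"
    then obtain T where "T \<subseteq> S" "finite T" "card T = Suc w"
      using infinite_arbitrarily_large by blast
    then show False using card_le[of T] by simp
  qed
  then show ?thesis using card_le[of S] unfolding S_def by blast
qed

end
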